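(* Every finitely generated nilpotent group is algebraically recurrent.
   Context: For a countable group $G$ and a probability measure $\mu$ on $G$, a $\mu$-random walk is $X_n=\zeta_1\cdots\zeta_n$ with $\zeta_i$ i.i.d. of law $\mu$; $\mathcal{S}_n$ denotes the semigroup generated by $\{X_n,X_{n+1},\ldots\}$. $(G,\mu)$ is algebraically recurrent (AR) if for every $n$, $\mathcal{S}_n=G$ almost surely; $G$ is AR if $(G,\mu)$ is AR for every symmetric probability measure $\mu$ (i.e. $\mu(g)=\mu(g^{-1})$) whose support generates $G$ as a group. *)

theory Defs
  imports "HOL-Probability.Probability" "HOL-Algebra.Generated_Groups"
begin

definition fin_generated :: "('a, 'b) monoid_scheme \<Rightarrow> bool" where
  "fin_generated G \<longleftrightarrow> (\<exists>S. finite S \<and> S \<subseteq> carrier G \<and> generate G S = carrier G)"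

text \<open>Lower central series: gamma_1 = G, gamma_(i+1) = [gamma_i, G], indexed from 0.\<close>
primrec lower_central :: "('a, 'b) monoid_scheme \<Rightarrow> nat \<Rightarrow> 'a set" where
  "lower_central G 0 = carrier G"
| "lower_central G (Suc n) =
     generate G {x \<otimes>\<^bsub>G\<^esub> y \<otimes>\<^bsub>G\<^esub> inv\<^bsub>G\<^esub> x \<otimes>\<^bsub>G\<^esub> inv\<^bsub>G\<^esub> y
                 | x y. x \<in> lower_central G n \<and> y \<in> carrier G}"

definition nilpotent_group :: "('a, 'b) monoid_scheme \<Rightarrow> bool" where
  "nilpotent_group G \<longleftrightarrow> group G \<and> (\<exists>n. lower_central G n = {\<one>\<^bsub>G\<^esub>})"

inductive_set semigroup_gen :: "('a, 'b) monoid_scheme \<Rightarrow> 'a set \<Rightarrow> 'a set"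
  for G and S where
  incl: "x \<in> S \<Longrightarrow> x \<in> semigroup_gen G S"
| mult: "x \<in> semigroup_gen G S \<Longrightarrow> y \<in> semigroup_gen G S \<Longrightarrow> x \<otimes>\<^bsub>G\<^esub> y \<in> semigroup_gen G S"

text \<open>Random walk X_n = zeta_1 ... zeta_n, with zeta_(i+1) = omega i; X_0 = 1.\<close>
primrec rwalk :: "('a, 'b) monoid_scheme \<Rightarrow> (nat \<Rightarrow> 'a) \<Rightarrow> nat \<Rightarrow> 'a" where
  "rwalk G \<omega> 0 = \<one>\<^bsub>G\<^esub>"
| "rwalk G \<omega> (Suc n) = rwalk G \<omega> n \<otimes>\<^bsub>G\<^esub> \<omega> n"

definition increments :: "'a pmf \<Rightarrow> (nat \<Rightarrow> 'a) measure" where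
  "increments \<mu> = (\<Pi>\<^sub>M i\<in>UNIV. measure_pmf \<mu>)"

definition symmetric_measure :: "('a, 'b) monoid_scheme \<Rightarrow> 'a pmf \<Rightarrow> bool" where
  "symmetric_measure G \<mu> \<longleftrightarrow> set_pmf \<mu> \<subseteq> carrier G \<and>
     (\<forall>g\<in>carrier G. pmf \<mu> (inv\<^bsub>G\<^esub> g) = pmf \<mu> g)"

definition alg_recurrent_measure :: "('a, 'b) monoid_scheme \<Rightarrow> 'a pmf \<Rightarrow> bool" where
  "alg_recurrent_measure G \<mu> \<longleftrightarrow>
     (\<forall>n. AE \<omega> in increments \<mu>. semigroup_gen G {rwalk G \<omega> m | m. m \<ge> n} = carrier G)"

definition alg_recurrent :: "('a, 'b) monoid_scheme \<Rightarrow> bool" where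
  "alg_recurrent G \<longleftrightarrow>
     (\<forall>\<mu> :: 'a pmf. symmetric_measure G \<mu> \<and> generate G (set_pmf \<mu>) = carrier G
        \<longrightarrow> alg_recurrent_measure G \<mu>)"

end

theory Submission
  imports Defs
begin

text \<open>
  It suffices that \<open>S\<^sub>n\<close> generates \<open>G\<close> and lies in no half-space of \<open>G\<close>, that is, that no nonzero
  homomorphism \<open>\<phi>\<close> from \<open>G\<close> to the reals is nonnegative on it. On the abelianisation this is Hoelder's
  theorem on ordered groups; it lifts along the lower central series, because the commutator of
  \<open>n\<close>-th powers grows quadratically in \<open>n\<close> while the error terms grow linearly.

  Let \<open>C\<close> be the random convex cone of all \<open>\<phi>\<close> with \<open>\<phi> X\<^sub>m \<ge> 0\<close> eventually. Since \<open>\<phi> X\<^sub>m\<close> is a sum over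
  the increments, \<open>C\<close> does not change when finitely many increments are permuted, so by the
  Hewitt--Savage law each compact box of functionals meets \<open>C\<close> with probability 0 or 1; as
  \<open>\<mu>\<close> is symmetric, the opposite box has the same probability. Hence almost surely the
  negative of each element of \<open>C\<close> is a limit of elements of \<open>C\<close>. By compactness this forces \<open>X\<^sub>m\<close> to be
  killed by the span of \<open>C\<close> for all large \<open>m\<close>, and therefore the increments too; as these exhaust the
  support of \<open>\<mu>\<close> infinitely often, \<open>C = 0\<close>.
\<close>

section \<open>Half-spaces and subsemigroups of abelian groups\<close>

text \<open>For one fixed nonzero \<open>\<phi>\<close>, symmetry and the zero-one law already make
  \<open>\<phi> X_m\<close> oscillate. The obstacle is that the functional may be chosen after the
  path is seen, from an uncountable family, while \<open>\<mu>\<close> carries no moment assumption,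
  so averages of increments are of no help. The zero-one law is therefore applied to countably many
  events that together locate \<open>C\<close>: the boxes, obtained by rounding the values on the
  generators to a grid. A box locates a functional only up to its size, and \<open>C\<close> need
  not be closed, since the time from which \<open>\<phi> X_m\<close> stays nonnegative depends on
  \<open>\<phi>\<close>. Hence negatives are obtained only approximately, and a contraction argument
  has to finish. Half-spaces see only the abelianisation, because real homomorphisms kill
  commutators; the deeper layers must follow from algebra alone. Finite generation enters three
  times: it supplies the largest Archimedean class, makes each layer of the lower central series
  finitely generated modulo the next, and makes the space of functionals finite-dimensional, so that
  boxes are compact.\<close>

definition real_hom :: "('a, 'b) monoid_scheme \<Rightarrow> ('a \<Rightarrow> real) \<Rightarrow> bool" where
  "real_hom G \<phi> \<longleftrightarrow> (\<forall>x\<in>carrier G. \<forall>y\<in>carrier G. \<phi> (x \<otimes>\<^bsub>G\<^esub> y) = \<phi> x + \<phi> y)"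

definition mult_closed :: "('a, 'b) monoid_scheme \<Rightarrow> 'a set \<Rightarrow> bool" where
  "mult_closed G S \<longleftrightarrow> S \<subseteq> carrier G \<and> (\<forall>x\<in>S. \<forall>y\<in>S. x \<otimes>\<^bsub>G\<^esub> y \<in> S)"

lemma mult_closedD: "mult_closed G S \<Longrightarrow> x \<in> S \<Longrightarrow> y \<in> S \<Longrightarrow> x \<otimes>\<^bsub>G\<^esub> y \<in> S"
  by (simp add: mult_closed_def)

lemma mult_closed_carrier: "mult_closed G S \<Longrightarrow> x \<in> S \<Longrightarrow> x \<in> carrier G"
  by (auto simp add: mult_closed_def)

lemma (in group) mult_closed_pow:
  assumes "mult_closed G S" "x \<in> S" "n > 0"
  shows "x [^] (n::nat) \<in> S"
  using assms(3)
proof (induction n rule: nat_induct_non_zero)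
  case 1
  show ?case using assms by (simp add: mult_closed_carrier)
next
  case (Suc n)
  then show ?case using assms by (simp add: mult_closed_def)
qed

lemma (in group) submonoid_pow:
  assumes "mult_closed G S" "\<one> \<in> S" "x \<in> S"
  shows "x [^] (n::nat) \<in> S"
  using assms mult_closed_pow[of S x n] by (cases "n = 0") auto

lemma (in group) real_hom_one:
  assumes "real_hom G \<phi>"
  shows "\<phi> \<one> = 0"
proof -
  have "\<phi> (\<one> \<otimes> \<one>) = \<phi> \<one> + \<phi> \<one>" using assms(1) unfolding real_hom_def by blast
  then show ?thesis by simp
qed

lemma (in group) real_hom_inv:
  assumes "real_hom G \<phi>" "x \<in> carrier G"
  shows "\<phi> (inv x) = - \<phi> x"
proof -
  have "\<phi> (x \<otimes> inv x) = \<phi> x + \<phi> (inv x)" using assms unfolding real_hom_def by blast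
  then show ?thesis using real_hom_one[OF assms(1)] assms(2) by simp
qed

lemma (in group) real_hom_pow:
  assumes "real_hom G \<phi>" "x \<in> carrier G"
  shows "\<phi> (x [^] (n::nat)) = real n * \<phi> x"
proof -
  show ?thesis
  proof (induction n)
    case 0
    then show ?case using real_hom_one[OF assms(1)] by simp
  next
    case (Suc n)
    have "\<phi> (x [^] n \<otimes> x) = \<phi> (x [^] n) + \<phi> x" using assms unfolding real_hom_def by blast
    then show ?case using Suc by (simp add: algebra_simps)
  qed
qed

lemma (in group) real_hom_eq_zero_generate:
  assumes "real_hom G \<phi>" "F \<subseteq> carrier G" "\<And>f. f \<in> F \<Longrightarrow> \<phi> f = 0" "x \<in> generate G F"
  shows "\<phi> x = 0"
proof -
  show ?thesis using assms(4)
  proof (induction x rule: generate.induct)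
    case one
    then show ?case using real_hom_one[OF assms(1)] .
  next
    case (incl h)
    then show ?case using assms(3) by blast
  next
    case (inv h)
    then show ?case using assms(2,3) real_hom_inv[OF assms(1), of h] by auto
  next
    case (eng h1 h2)
    then have "h1 \<in> carrier G" "h2 \<in> carrier G"
      using generate_in_carrier[OF assms(2)] by auto
    then show ?case using eng assms(1) unfolding real_hom_def by auto
  qed
qed

text \<open>Zorn's lemma gives a maximal submonoid \<open>P\<close> above \<open>T\<close> that
  avoids \<open>inv t\<close>: the nonnegative cone of a total translation-invariant preorder in
  which \<open>t\<close> is strictly positive. Totality is forced by maximality: adjoining
  \<open>g\<close> or \<open>inv g\<close> would each produce \<open>inv t\<close>, and combining
  powers of the two equations cancels \<open>g\<close>.\<close>

lemma (in comm_group) exists_total_submonoid: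
  assumes T: "mult_closed G T" and t: "t \<in> T" "inv t \<notin> T"
  obtains P where "mult_closed G P" "T \<subseteq> P" "\<one> \<in> P" "inv t \<notin> P"
    "\<And>g. g \<in> carrier G \<Longrightarrow> g \<in> P \<or> inv g \<in> P"
proof -
  define Q where "Q = {P. mult_closed G P \<and> T \<subseteq> P \<and> \<one> \<in> P \<and> inv t \<notin> P}"
  have tc: "t \<in> carrier G" using T t by (auto simp: mult_closed_def)
  have "inv t \<noteq> \<one>" using t tc by (metis inv_eq_1_iff)
  then have Q0: "insert \<one> T \<in> Q"
    using T t unfolding Q_def mult_closed_def by auto
  have "\<exists>M\<in>Q. \<forall>X\<in>Q. M \<subseteq> X \<longrightarrow> X = M"
  proof (rule subset_Zorn_nonempty)
    show "Q \<noteq> {}" using Q0 by blast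
    fix C assume C: "C \<noteq> {}" "subset.chain Q C"
    have CQ: "C \<subseteq> Q" and lin: "\<And>X Y. X \<in> C \<Longrightarrow> Y \<in> C \<Longrightarrow> X \<subseteq> Y \<or> Y \<subseteq> X"
      using C by (auto simp: subset.chain_def)
    have "mult_closed G (\<Union>C)"
      unfolding mult_closed_def
    proof (intro conjI ballI)
      show "\<Union>C \<subseteq> carrier G" using CQ by (auto simp: Q_def mult_closed_def)
      fix x y assume "x \<in> \<Union>C" "y \<in> \<Union>C"
      then obtain X Y where XY: "X \<in> C" "x \<in> X" "Y \<in> C" "y \<in> Y" by blast
      have "\<exists>Z\<in>C. x \<in> Z \<and> y \<in> Z" using lin[OF XY(1,3)] XY by (meson subsetD)
      then obtain Z where "Z \<in> C" "x \<in> Z" "y \<in> Z" by blast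
      moreover have "mult_closed G Z" using \<open>Z \<in> C\<close> CQ by (auto simp: Q_def)
      ultimately show "x \<otimes> y \<in> \<Union>C" using mult_closedD[of G Z x y] by auto
    qed
    moreover have "T \<subseteq> \<Union>C" "\<one> \<in> \<Union>C" "inv t \<notin> \<Union>C"
      using C(1) CQ unfolding Q_def by auto
    ultimately show "\<Union>C \<in> Q" unfolding Q_def by simp
  qed
  then obtain P where PQ: "P \<in> Q" and max: "\<And>X. X \<in> Q \<Longrightarrow> P \<subseteq> X \<Longrightarrow> X = P" by blast
  have P: "mult_closed G P" "T \<subseteq> P" "\<one> \<in> P" "inv t \<notin> P" using PQ by (auto simp: Q_def)
  note PC = mult_closed_carrier[OF P(1)]
  have ext: "\<exists>p\<in>P. \<exists>k>0. p \<otimes> g [^] (k::nat) = inv t" if g: "g \<in> carrier G" "g \<notin> P" for g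
  proof -
    define P1 where "P1 = {p \<otimes> g [^] (k::nat) | p k. p \<in> P}"
    have "p \<in> P1" if "p \<in> P" for p
    proof -
      have "p = p \<otimes> g [^] (0::nat)" using PC[OF that] by simp
      then show ?thesis using that unfolding P1_def by blast
    qed
    then have sub: "P \<subseteq> P1" by blast
    have "g = \<one> \<otimes> g [^] (1::nat)" using g by simp
    then have "g \<in> P1" using P(3) unfolding P1_def by blast
    have "mult_closed G P1"
      unfolding mult_closed_def
    proof (intro conjI ballI)
      show "P1 \<subseteq> carrier G" using PC g by (auto simp: P1_def)
      fix x y assume "x \<in> P1" "y \<in> P1"
      then obtain p k q l where x: "x = p \<otimes> g [^] (k::nat)" "p \<in> P"
        and y: "y = q \<otimes> g [^] (l::nat)" "q \<in> P" unfolding P1_def by blast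
      have "x \<otimes> y = (p \<otimes> q) \<otimes> g [^] (k + l)"
        using x y g PC by (simp add: nat_pow_mult[symmetric] m_ac)
      moreover have "p \<otimes> q \<in> P" using mult_closedD[OF P(1)] x y by blast
      ultimately show "x \<otimes> y \<in> P1" unfolding P1_def by blast
    qed
    moreover have "P1 \<noteq> P" using \<open>g \<in> P1\<close> g by blast
    ultimately have "inv t \<in> P1" using max[of P1] sub P unfolding Q_def by blast
    then obtain p k where pk: "p \<in> P" "p \<otimes> g [^] (k::nat) = inv t" unfolding P1_def by force
    have "k > 0" using pk P(4) PC by (cases "k = 0") auto
    then show ?thesis using pk by blast
  qed
  have "g \<in> P \<or> inv g \<in> P" if g: "g \<in> carrier G" for g
  proof (rule ccontr)
    assume *: "\<not> ?thesis"
    obtain p k where p: "p \<in> P" "k > 0" "p \<otimes> g [^] (k::nat) = inv t" using ext[of g] g * by blast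
    obtain q l where q: "q \<in> P" "l > 0" "q \<otimes> inv g [^] (l::nat) = inv t"
      using ext[of "inv g"] g * by blast
    have pc: "p \<in> carrier G" "q \<in> carrier G" using p q PC by auto
    \<comment> \<open>Raising the two equations to the powers \<open>l\<close> and \<open>k\<close>
      gives \<open>g\<close> and \<open>inv g\<close> the same exponent
      \<open>k * l\<close>.\<close>
    have 1: "inv t [^] l = p [^] l \<otimes> g [^] (k * l)"
      using p(3)[symmetric] pc g by (simp add: nat_pow_distrib nat_pow_pow)
    have 2: "inv t [^] k = q [^] k \<otimes> inv g [^] (k * l)"
      using q(3)[symmetric] pc g by (simp add: nat_pow_distrib nat_pow_pow mult.commute)
    have 3: "g [^] (k * l) \<otimes> inv g [^] (k * l) = \<one>"
      using g by (simp add: nat_pow_distrib[symmetric])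
    have "inv t [^] (l + k) = (p [^] l \<otimes> q [^] k) \<otimes> (g [^] (k * l) \<otimes> inv g [^] (k * l))"
      unfolding nat_pow_mult[OF inv_closed[OF tc], symmetric] 1 2 using pc g by (simp add: m_ac)
    then have "inv t [^] (l + k) = p [^] l \<otimes> q [^] k" using 3 pc by simp
    then have 4: "inv t [^] (l + k) \<in> P"
      using p q submonoid_pow[OF P(1,3)] mult_closedD[OF P(1)] by simp
    obtain j where j: "l + k = Suc j" using p by (cases "l + k") auto
    \<comment> \<open>Multiplying by \<open>t\<close> to the power \<open>l + k - 1\<close> leaves a
      single \<open>inv t\<close>, the element that \<open>P\<close> avoids.\<close>
    have "t [^] j \<otimes> (inv t [^] j \<otimes> inv t) = inv t"
      using tc by (simp add: m_assoc[symmetric] nat_pow_distrib[symmetric])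
    then have "t [^] j \<otimes> inv t [^] (l + k) = inv t" using j by simp
    moreover have "t [^] j \<in> P" using submonoid_pow[OF P(1,3)] P(2) t by blast
    ultimately show False using 4 mult_closedD[OF P(1)] P(4) by metis
  qed
  then show ?thesis using that P by blast
qed

text \<open>Hoelder's argument: the functional measures elements of the totally preordered group
  against an element \<open>e\<close> of the largest Archimedean class, which exists by finite generation.\<close>

lemma (in comm_group) exists_real_hom_nonneg:
  assumes F: "finite F" "F \<subseteq> carrier G" "generate G F = carrier G"
    and T: "mult_closed G T" and t: "t \<in> T" "inv t \<notin> T"
  obtains \<phi> where "real_hom G \<phi>" "\<And>x. x \<in> T \<Longrightarrow> \<phi> x \<ge> 0" "\<exists>x\<in>carrier G. \<phi> x \<noteq> 0"
proof -
  obtain P where P: "mult_closed G P" "T \<subseteq> P" "\<one> \<in> P" "inv t \<notin> P"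
    and total: "\<And>g. g \<in> carrier G \<Longrightarrow> g \<in> P \<or> inv g \<in> P"
    using exists_total_submonoid[OF T t] by blast
  note PC = mult_closed_carrier[OF P(1)] and PM = mult_closedD[OF P(1)]
    and PP = submonoid_pow[OF P(1,3)]
  have tc: "t \<in> carrier G" using P(2) t PC by blast
  \<comment> \<open>Take for \<open>e\<close> the product over \<open>f\<close> in \<open>F\<close>
    of whichever of \<open>f\<close>, \<open>inv f\<close> lies in \<open>P\<close>; it dominates
    every generator and its inverse.\<close>
  have "\<exists>e\<in>P. \<forall>f\<in>F. e \<otimes> f \<in> P \<and> e \<otimes> inv f \<in> P"
    using F(1,2)
  proof (induction F rule: finite_induct)
    case empty
    then show ?case using P(3) by blast
  next
    case (insert f F)
    then obtain e where e: "e \<in> P" "\<forall>f\<in>F. e \<otimes> f \<in> P \<and> e \<otimes> inv f \<in> P" by auto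
    have fc: "f \<in> carrier G" and Fc: "\<And>h. h \<in> F \<Longrightarrow> h \<in> carrier G" using insert by auto
    obtain a where a: "a \<in> P" "a = f \<or> a = inv f" using total[OF fc] by blast
    have "a \<otimes> f \<in> P \<and> a \<otimes> inv f \<in> P" using a PM[OF a(1) a(1)] P(3) fc by auto
    then have "e \<otimes> (a \<otimes> f) \<in> P \<and> e \<otimes> (a \<otimes> inv f) \<in> P" using PM e(1) by blast
    moreover have "a \<otimes> (e \<otimes> h) \<in> P \<and> a \<otimes> (e \<otimes> inv h) \<in> P" if "h \<in> F" for h
      using PM a(1) e(2) that by blast
    ultimately have "\<forall>h\<in>insert f F. (e \<otimes> a) \<otimes> h \<in> P \<and> (e \<otimes> a) \<otimes> inv h \<in> P"
      using PC[OF e(1)] PC[OF a(1)] fc Fc by (auto simp: m_ac)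
    then show ?case using PM[OF e(1) a(1)] by blast
  qed
  then obtain e where eP: "e \<in> P" and eF: "\<And>f. f \<in> F \<Longrightarrow> e \<otimes> f \<in> P \<and> e \<otimes> inv f \<in> P" by blast
  have ec: "e \<in> carrier G" using PC eP .
  have bound: "\<exists>N::nat. e [^] N \<otimes> g \<in> P \<and> e [^] N \<otimes> inv g \<in> P" if "g \<in> carrier G" for g
    using that[folded F(3)]
  proof (induction g rule: generate.induct)
    case one
    have "e [^] (0::nat) \<otimes> \<one> \<in> P \<and> e [^] (0::nat) \<otimes> inv \<one> \<in> P" using P(3) by simp
    then show ?case by blast
  next
    case (incl h)
    then have "e [^] (1::nat) \<otimes> h \<in> P \<and> e [^] (1::nat) \<otimes> inv h \<in> P" using eF ec by simp
    then show ?case by blast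
  next
    case (inv h)
    then have "e [^] (1::nat) \<otimes> h \<in> P \<and> e [^] (1::nat) \<otimes> inv h \<in> P" using eF ec by simp
    then show ?case using F(2) inv by (metis inv_inv subsetD)
  next
    case (eng g h)
    then obtain N K where N: "e [^] (N::nat) \<otimes> g \<in> P" "e [^] N \<otimes> inv g \<in> P"
      and K: "e [^] (K::nat) \<otimes> h \<in> P" "e [^] K \<otimes> inv h \<in> P" by blast
    have gh: "g \<in> carrier G" "h \<in> carrier G" using eng F by auto
    have "e [^] (N + K) \<otimes> (g \<otimes> h) = (e [^] N \<otimes> g) \<otimes> (e [^] K \<otimes> h)"
      "e [^] (N + K) \<otimes> inv (g \<otimes> h) = (e [^] N \<otimes> inv g) \<otimes> (e [^] K \<otimes> inv h)"
      using gh ec by (simp_all add: nat_pow_mult[symmetric] m_ac inv_mult)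
    then show ?case using PM N K by metis
  qed
  \<comment> \<open>Some power of \<open>e\<close> dominates \<open>t\<close>, so \<open>e\<close>
    inherits strict positivity from \<open>t\<close>.\<close>
  have e_pos: "inv e \<notin> P"
  proof
    assume ie: "inv e \<in> P"
    obtain N where "e [^] (N::nat) \<otimes> inv t \<in> P" using bound[OF inv_closed[OF tc]] by blast
    then have "inv e [^] N \<otimes> (e [^] N \<otimes> inv t) \<in> P" using PM PP ie by blast
    moreover have "inv e [^] N \<otimes> (e [^] N \<otimes> inv t) = inv t"
      using ec tc by (simp add: m_assoc[symmetric] nat_pow_distrib[symmetric])
    ultimately show False using P(4) by simp
  qed
  have e_int: "e [^] (p::int) \<in> P \<longleftrightarrow> p \<ge> 0" for p
  proof
    assume "p \<ge> 0"
    then show "e [^] p \<in> P" using PP[OF eP, of "nat p"] by (simp add: int_pow_int[symmetric])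
  next
    assume a: "e [^] p \<in> P"
    show "p \<ge> 0"
    proof (rule ccontr)
      assume "\<not> p \<ge> 0"
      then have "e [^] (nat (- p - 1)) \<otimes> e [^] p = inv e"
        using ec by (simp add: int_pow_int[symmetric] int_pow_mult[symmetric] int_pow_neg)
      then show False using PM[OF PP[OF eP] a, of "nat (- p - 1)"] e_pos by simp
    qed
  qed
  \<comment> \<open>These are the rationals \<open>p / q\<close> for which \<open>e^p\<close> lies
    below \<open>g^q\<close>: the lower half of the Dedekind cut that measures \<open>g\<close> in
    units of \<open>e\<close>.\<close>
  define L where "L g = {real_of_int p / real q | p q. q > (0::nat) \<and> g [^] q \<otimes> e [^] (- p) \<in> P}" for g
  define \<phi> where "\<phi> g = Sup (L g)" for g
  have LI: "real_of_int p / real q \<in> L g" if "q > 0" "g [^] q \<otimes> e [^] (- p) \<in> P" for g p q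
    using that unfolding L_def by blast
  have upper: "real_of_int p / real q \<le> real N"
    if "g \<in> carrier G" "q > 0" "g [^] q \<otimes> e [^] (- p) \<in> P" "e [^] N \<otimes> inv g \<in> P" for g p q and N :: nat
  proof -
    have "(e [^] N \<otimes> inv g) [^] q \<otimes> (g [^] q \<otimes> e [^] (- p)) \<in> P" using that PM PP by blast
    moreover have "(e [^] N \<otimes> inv g) [^] q \<otimes> (g [^] q \<otimes> e [^] (- p)) = e [^] (int (N * q) - p)"
    proof -
      have "(e [^] N \<otimes> inv g) [^] q \<otimes> (g [^] q \<otimes> e [^] (- p))
        = (e [^] (N * q) \<otimes> e [^] (- p)) \<otimes> (inv g [^] q \<otimes> g [^] q)"
        using that ec by (simp add: nat_pow_distrib nat_pow_pow m_ac)
      also have "inv g [^] q \<otimes> g [^] q = \<one>"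
        using that by (simp add: nat_pow_distrib[symmetric])
      finally show ?thesis using ec
        by (simp add: int_pow_int[symmetric] int_pow_mult[symmetric] del: of_nat_mult)
    qed
    ultimately have "p \<le> int (N * q)" using e_int by simp
    then have "real_of_int p \<le> real N * real q" by (metis of_int_le_iff of_int_of_nat_eq of_nat_mult)
    then show ?thesis using that(2) by (simp add: divide_le_eq)
  qed
  have bdd: "bdd_above (L g)" if "g \<in> carrier G" for g
  proof -
    obtain N where "e [^] (N::nat) \<otimes> inv g \<in> P" using bound \<open>g \<in> carrier G\<close> by blast
    then show ?thesis using upper[OF that] unfolding L_def by (intro bdd_aboveI[of _ "real N"]) auto
  qed
  have ne: "L g \<noteq> {}" if "g \<in> carrier G" for g
  proof -
    obtain N where "e [^] (N::nat) \<otimes> g \<in> P" using bound \<open>g \<in> carrier G\<close> by blast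
    then have "g [^] (1::nat) \<otimes> e [^] (- (- int N)) \<in> P" using that ec by (simp add: int_pow_int m_comm)
    then show ?thesis using LI[of 1 g "- int N"] by auto
  qed
  have super: "\<phi> g + \<phi> h \<le> \<phi> (g \<otimes> h)" if gh: "g \<in> carrier G" "h \<in> carrier G" for g h
  proof -
    have add: "a + b \<in> L (g \<otimes> h)" if "a \<in> L g" "b \<in> L h" for a b
    proof -
      obtain p q where a: "a = real_of_int p / real q" "q > 0" "g [^] q \<otimes> e [^] (- p) \<in> P"
        using \<open>a \<in> L g\<close> unfolding L_def by blast
      obtain r s where b: "b = real_of_int r / real s" "s > 0" "h [^] s \<otimes> e [^] (- r) \<in> P"
        using \<open>b \<in> L h\<close> unfolding L_def by blast
      have "(g [^] q \<otimes> e [^] (- p)) [^] s \<otimes> (h [^] s \<otimes> e [^] (- r)) [^] q \<in> P"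
        using a b PM PP by blast
      moreover have "(g [^] q \<otimes> e [^] (- p)) [^] s \<otimes> (h [^] s \<otimes> e [^] (- r)) [^] q
        = (g \<otimes> h) [^] (q * s) \<otimes> e [^] (- (p * int s + r * int q))"
      proof -
        have "(e [^] (- p)) [^] s \<otimes> (e [^] (- r)) [^] q = e [^] (- (p * int s + r * int q))"
          using ec by (simp add: int_pow_int[symmetric] int_pow_pow int_pow_mult[symmetric])
        moreover have "(g [^] q \<otimes> e [^] (- p)) [^] s \<otimes> (h [^] s \<otimes> e [^] (- r)) [^] q
          = (g \<otimes> h) [^] (q * s) \<otimes> ((e [^] (- p)) [^] s \<otimes> (e [^] (- r)) [^] q)"
          using ec gh by (simp add: nat_pow_distrib nat_pow_pow m_ac mult.commute)
        ultimately show ?thesis by simp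
      qed
      moreover have "a + b = real_of_int (p * int s + r * int q) / real (q * s)"
        using a b by (simp add: field_simps)
      ultimately show ?thesis
        using a(2) b(2) LI[of "q * s" "g \<otimes> h" "p * int s + r * int q"] by simp
    qed
    have "\<phi> g \<le> \<phi> (g \<otimes> h) - b" if "b \<in> L h" for b
      unfolding \<phi>_def
    proof (rule cSup_least[OF ne[OF gh(1)]])
      fix a assume "a \<in> L g"
      then have "a + b \<le> Sup (L (g \<otimes> h))" using add that bdd gh by (intro cSup_upper) auto
      then show "a \<le> Sup (L (g \<otimes> h)) - b" by simp
    qed
    then have "b \<le> \<phi> (g \<otimes> h) - \<phi> g" if "b \<in> L h" for b using that by fastforce
    then have "\<phi> h \<le> \<phi> (g \<otimes> h) - \<phi> g" unfolding \<phi>_def[of h] by (intro cSup_least[OF ne[OF gh(2)]])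
    then show ?thesis by simp
  qed
  have one: "\<phi> \<one> = 0"
    unfolding \<phi>_def
  proof (rule cSup_eq_maximum)
    have "\<one> [^] (1::nat) \<otimes> e [^] (- 0 :: int) \<in> P" using P(3) by simp
    then show "0 \<in> L \<one>" unfolding L_def by force
    fix x assume "x \<in> L \<one>"
    then show "x \<le> 0" using e_int ec unfolding L_def by (auto simp: divide_nonpos_pos)
  qed
  \<comment> \<open>Totality makes the cut tight: either \<open>p / q\<close> is a lower bound for
    \<open>g\<close>, or its negative is one for \<open>inv g\<close>. The resulting oddness turns
    superadditivity into additivity.\<close>
  have neg: "- \<phi> (inv g) \<le> \<phi> g" if g: "g \<in> carrier G" for g
  proof (rule ccontr)
    assume "\<not> ?thesis"
    then have "\<phi> g < - \<phi> (inv g)" by simp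
    then obtain r :: rat where r: "\<phi> g < of_rat r" "of_rat r < - \<phi> (inv g)"
      using of_rat_dense by blast
    obtain p d where "quotient_of r = (p, d)" by fastforce
    then have pd: "r = of_int p / of_int d" "d > 0"
      using quotient_of_div quotient_of_denom_pos by blast+
    define q where "q = nat d"
    have q: "q > 0" "of_rat r = real_of_int p / real q" using pd by (auto simp: q_def of_rat_divide)
    show False
    proof (cases "g [^] q \<otimes> e [^] (- p) \<in> P")
      case True
      then have "of_rat r \<in> L g" using q unfolding L_def by blast
      then have "of_rat r \<le> \<phi> g" unfolding \<phi>_def using bdd[OF g] by (intro cSup_upper)
      then show False using r by simp
    next
      case False
      then have "inv (g [^] q \<otimes> e [^] (- p)) \<in> P" using total[of "g [^] q \<otimes> e [^] (- p)"] g ec by blast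
      moreover have "inv (g [^] q \<otimes> e [^] (- p)) = inv g [^] q \<otimes> e [^] (- (- p))"
        using g ec by (simp add: inv_mult nat_pow_inv int_pow_neg)
      ultimately have "- of_rat r \<in> L (inv g)" using q LI[of q "inv g" "- p"] by simp
      then have "- of_rat r \<le> \<phi> (inv g)" unfolding \<phi>_def using bdd g by (intro cSup_upper) auto
      then show False using r by simp
    qed
  qed
  have inv: "\<phi> (inv g) = - \<phi> g" if g: "g \<in> carrier G" for g
    using super[of g "inv g"] neg[OF g] g one by simp
  have "\<phi> (g \<otimes> h) = \<phi> g + \<phi> h" if gh: "g \<in> carrier G" "h \<in> carrier G" for g h
    using super[of g h] super[of "inv g" "inv h"] gh inv inv[of "g \<otimes> h"] inv_mult[OF gh] by simp
  then have hom: "real_hom G \<phi>" unfolding real_hom_def by blast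
  have nonneg: "\<phi> x \<ge> 0" if "x \<in> T" for x
  proof -
    have "x [^] (1::nat) \<otimes> e [^] (- 0 :: int) \<in> P" using that P(2) PC by auto
    then have "real_of_int 0 / real 1 \<in> L x" unfolding L_def by blast
    then show ?thesis unfolding \<phi>_def using bdd[of x] that P(2) PC by (intro cSup_upper) auto
  qed
  have "e [^] (1::nat) \<otimes> e [^] (- 1 :: int) \<in> P" using P(3) ec by (simp add: int_pow_neg)
  then have "real_of_int 1 / real 1 \<in> L e" unfolding L_def by blast
  then have "1 \<le> \<phi> e" unfolding \<phi>_def using bdd[OF ec] by (intro cSup_upper) auto
  then have "\<exists>x\<in>carrier G. \<phi> x \<noteq> 0" using ec by force
  then show ?thesis using that hom nonneg by blast
qed

section \<open>Central extensions\<close>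

lemma (in group) inv_mult_cancel:
  assumes "x \<in> carrier G" "y \<in> carrier G"
  shows "inv x \<otimes> (x \<otimes> y) = y" "x \<otimes> (inv x \<otimes> y) = y"
  using assms by (simp_all add: m_assoc[symmetric])

lemma (in group) commute_generate:
  assumes "X \<subseteq> carrier G" "y \<in> carrier G" "\<And>x. x \<in> X \<Longrightarrow> x \<otimes> y = y \<otimes> x" "x \<in> generate G X"
  shows "x \<otimes> y = y \<otimes> x"
  using assms(4)
proof (induction x rule: generate.induct)
  case one
  then show ?case using assms by simp
next
  case (incl h)
  then show ?case using assms by blast
next
  case (inv h)
  then have h: "h \<in> carrier G" "h \<otimes> y = y \<otimes> h" using assms by auto
  have "inv h \<otimes> y = inv h \<otimes> (y \<otimes> h) \<otimes> inv h" using h(1) assms(2) by (simp add: m_assoc)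
  also have "\<dots> = y \<otimes> inv h" unfolding h(2)[symmetric] using h(1) assms(2) by (simp add: m_assoc[symmetric])
  finally show ?case .
next
  case (eng a b)
  then have "a \<in> carrier G" "b \<in> carrier G" using generate_in_carrier[OF assms(1)] by auto
  then show ?case using eng assms(2) by (metis m_assoc)
qed

text \<open>Each of the \<open>n * m\<close> moves of an \<open>s\<close> past a \<open>t\<close>
  releases one central factor \<open>c\<close>. This is the source of the quadratic
  exponent.\<close>

lemma (in group) commutator_pow:
  assumes "s \<in> carrier G" "t \<in> carrier G" "c \<in> carrier G"
    and central: "\<And>x. x \<in> carrier G \<Longrightarrow> c \<otimes> x = x \<otimes> c"
    and st: "s \<otimes> t = c \<otimes> (t \<otimes> s)"
  shows "s [^] (n::nat) \<otimes> t [^] (m::nat) = c [^] (n * m) \<otimes> (t [^] m \<otimes> s [^] n)"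
proof -
  have cn: "c [^] (k::nat) \<otimes> x = x \<otimes> c [^] k" if "x \<in> carrier G" for k x
    using group_commutes_pow[OF central[OF that]] assms that by blast
  have 1: "s [^] n \<otimes> t = c [^] n \<otimes> (t \<otimes> s [^] n)" for n :: nat
  proof (induction n)
    case 0
    then show ?case using assms by simp
  next
    case (Suc n)
    have "s [^] Suc n \<otimes> t = s [^] n \<otimes> (c \<otimes> (t \<otimes> s))" using assms by (simp add: m_assoc)
    also have "\<dots> = (s [^] n \<otimes> c) \<otimes> (t \<otimes> s)" using assms by (simp add: m_assoc)
    also have "\<dots> = c \<otimes> (s [^] n \<otimes> t) \<otimes> s"
      unfolding central[OF nat_pow_closed[OF assms(1)], symmetric] using assms by (simp add: m_assoc)
    also have "\<dots> = c [^] Suc n \<otimes> (t \<otimes> s [^] Suc n)"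
      unfolding Suc using assms nat_pow_Suc2[of c n] by (simp add: m_assoc)
    finally show ?case .
  qed
  show ?thesis
  proof (induction m)
    case 0
    then show ?case using assms by simp
  next
    case (Suc m)
    have "s [^] n \<otimes> t [^] Suc m = c [^] (n * m) \<otimes> t [^] m \<otimes> (s [^] n \<otimes> t)"
      using Suc assms by (simp add: m_assoc[symmetric])
    also have "\<dots> = c [^] (n * m) \<otimes> (t [^] m \<otimes> c [^] n) \<otimes> (t \<otimes> s [^] n)"
      unfolding 1 using assms by (simp add: m_assoc)
    also have "\<dots> = c [^] (n * m) \<otimes> c [^] n \<otimes> (t [^] Suc m \<otimes> s [^] n)"
      using assms cn[of "t [^] m" n, symmetric] by (simp add: m_assoc)
    also have "c [^] (n * m) \<otimes> c [^] n = c [^] (n * Suc m)"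
      using assms by (simp add: nat_pow_mult add.commute)
    finally show ?case .
  qed
qed

text \<open>With the true inverses of \<open>s\<close> and \<open>t\<close> the word would be a pure
  power of \<open>c\<close>. A semigroup offers these inverses only up to central errors
  \<open>u\<close> and \<open>v\<close>, which enter to the power \<open>n\<close> while
  \<open>c\<close> enters to the power \<open>n * n\<close>.\<close>

lemma (in group) commutator_word_pow:
  assumes "s \<in> carrier G" "t \<in> carrier G" "c \<in> carrier G" "u \<in> carrier G" "v \<in> carrier G"
    and central: "\<And>x. x \<in> carrier G \<Longrightarrow> c \<otimes> x = x \<otimes> c" "\<And>x. x \<in> carrier G \<Longrightarrow> u \<otimes> x = x \<otimes> u"
      "\<And>x. x \<in> carrier G \<Longrightarrow> v \<otimes> x = x \<otimes> v"
    and st: "s \<otimes> t = c \<otimes> (t \<otimes> s)"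
  shows "s [^] (n::nat) \<otimes> t [^] n \<otimes> (inv s \<otimes> u) [^] n \<otimes> (inv t \<otimes> v) [^] n
    = c [^] (n * n) \<otimes> u [^] n \<otimes> v [^] n"
proof -
  have un: "u [^] (k::nat) \<otimes> x = x \<otimes> u [^] k" if "x \<in> carrier G" for k x
    using group_commutes_pow[OF central(2)[OF that]] assms that by blast
  have "(inv s \<otimes> u) [^] n = inv (s [^] n) \<otimes> u [^] n" "(inv t \<otimes> v) [^] n = inv (t [^] n) \<otimes> v [^] n"
    using assms by (simp_all add: pow_mult_distrib nat_pow_inv)
  then have "s [^] n \<otimes> t [^] n \<otimes> (inv s \<otimes> u) [^] n \<otimes> (inv t \<otimes> v) [^] n
    = c [^] (n * n) \<otimes> t [^] n \<otimes> (s [^] n \<otimes> inv (s [^] n)) \<otimes> (u [^] n \<otimes> inv (t [^] n)) \<otimes> v [^] n"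
    using commutator_pow[OF assms(1,2,3) central(1) st, of n n] assms(1-5)
    by (simp add: m_assoc inv_mult_cancel)
  also have "u [^] n \<otimes> inv (t [^] n) = inv (t [^] n) \<otimes> u [^] n" using un assms by simp
  also have "c [^] (n * n) \<otimes> t [^] n \<otimes> (s [^] n \<otimes> inv (s [^] n)) \<otimes> (inv (t [^] n) \<otimes> u [^] n) \<otimes> v [^] n
     = c [^] (n * n) \<otimes> (t [^] n \<otimes> inv (t [^] n)) \<otimes> u [^] n \<otimes> v [^] n"
    using assms(1-5) by (simp add: m_assoc inv_mult_cancel)
  finally show ?thesis using assms(1-5) by simp
qed

abbreviation commutator :: "('a, 'b) monoid_scheme \<Rightarrow> 'a \<Rightarrow> 'a \<Rightarrow> 'a" where
  "commutator G x y \<equiv> x \<otimes>\<^bsub>G\<^esub> y \<otimes>\<^bsub>G\<^esub> inv\<^bsub>G\<^esub> x \<otimes>\<^bsub>G\<^esub> inv\<^bsub>G\<^esub> y"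

text \<open>Here \<open>a\<close> will be the value on a commutator and \<open>b\<close> that of the
  error terms, after a common factor \<open>n\<close> has been divided out.\<close>

lemma linear_dominates_imp_zero:
  fixes a b :: real
  assumes "\<And>n::nat. n > 0 \<Longrightarrow> real n * a + b \<ge> 0" "\<And>n::nat. n > 0 \<Longrightarrow> - (real n * a) + b \<ge> 0"
  shows "a = 0"
proof (rule ccontr)
  assume "a \<noteq> 0"
  then obtain n where n: "real n * \<bar>a\<bar> > b" using reals_Archimedean3[of "\<bar>a\<bar>"] by auto
  then have "real (Suc n) * \<bar>a\<bar> > b" by (simp add: algebra_simps)
  then show False using assms(1)[of "Suc n"] assms(2)[of "Suc n"] by (cases "a \<ge> 0") auto
qed

text \<open>A functional that is nonnegative on \<open>S \<inter> Z\<close> vanishes on every \<open>c = [e, f]\<close>: lifts \<open>s, t\<close> of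
  \<open>e, f\<close> and of their inverses to \<open>S\<close> give elements \<open>c\<^bsup>\<plusminus>n\<^sup>2\<^esup> u\<^sup>n v\<^sup>n\<close> of \<open>S \<inter> Z\<close>, whose leading term is
  quadratic.\<close>

lemma (in group) semigroup_central_extension:
  assumes C: "finite C" "C \<subseteq> carrier G"
    and comm: "\<And>c. c \<in> C \<Longrightarrow> \<exists>e\<in>carrier G. \<exists>f\<in>carrier G. c = commutator G e f"
    and central: "\<And>c g. c \<in> C \<Longrightarrow> g \<in> carrier G \<Longrightarrow> c \<otimes> g = g \<otimes> c"
    and S: "mult_closed G S" and sup: "\<And>g. g \<in> carrier G \<Longrightarrow> \<exists>z\<in>generate G C. g \<otimes> z \<in> S"
  shows "S = carrier G"
proof -
  define Z where "Z = generate G C"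
  have ZG: "subgroup Z G" unfolding Z_def using generate_is_subgroup C(2) by blast
  have Zc: "z \<in> carrier G" if "z \<in> Z" for z using subgroup.subset[OF ZG] that by blast
  have Zcent: "z \<otimes> g = g \<otimes> z" if "z \<in> Z" "g \<in> carrier G" for z g
    using commute_generate[OF C(2) that(2) central] that unfolding Z_def by blast
  have Zpow: "z [^] (n::nat) \<in> Z" if "z \<in> Z" for z n
    using that ZG by (induction n) (auto intro: subgroup.m_closed subgroup.one_closed)
  define A where "A = G\<lparr>carrier := Z\<rparr>"
  have "group A" unfolding A_def by (rule subgroup_imp_group[OF ZG])
  then interpret A: comm_group A
    by (rule group.group_comm_groupI) (use Zc Zcent in \<open>auto simp: A_def\<close>)
  have CZ: "C \<subseteq> Z" unfolding Z_def by (auto intro: generate.incl)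
  have genA: "generate A C = carrier A"
  proof -
    have "generate (G\<lparr>carrier := Z\<rparr>) C = generate G C" using generate_consistent CZ ZG by blast
    then show ?thesis by (simp add: A_def Z_def)
  qed
  have invA: "inv\<^bsub>A\<^esub> z = inv z" if "z \<in> Z" for z
    unfolding A_def using m_inv_consistent[OF ZG that] by simp
  have invZ: "inv z \<in> Z" if "z \<in> Z" for z using subgroup.m_inv_closed[OF ZG that] .
  have mZ: "y \<otimes> z \<in> Z" if "y \<in> Z" "z \<in> Z" for y z using subgroup.m_closed[OF ZG that] .
  define T where "T = S \<inter> Z"
  have TA: "mult_closed A T"
    using S mZ unfolding T_def A_def by (auto simp: mult_closed_def)
  \<comment> \<open>\<open>s\<close> and \<open>t\<close> are elements of \<open>S\<close> above
    \<open>e\<close> and \<open>f\<close>; they have the same commutator \<open>c\<close> because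
    the corrections \<open>y\<close> and \<open>z\<close> are central. The element \<open>u\<close>
    is the product of \<open>s\<close> and \<open>inv s \<otimes> u\<close>, both in
    \<open>S\<close>, hence lies in \<open>T\<close>; likewise \<open>v\<close>.\<close>
  have lift: "\<exists>s t u v. s \<in> S \<and> t \<in> S \<and> inv s \<otimes> u \<in> S \<and> inv t \<otimes> v \<in> S \<and> u \<in> T \<and> v \<in> T
      \<and> s \<otimes> t = c \<otimes> (t \<otimes> s)" if c: "c \<in> C" for c
  proof -
    obtain e f where ef: "e \<in> carrier G" "f \<in> carrier G" "c = commutator G e f" using comm[OF c] by blast
    obtain y where y: "y \<in> Z" "e \<otimes> y \<in> S" using sup[OF ef(1)] unfolding Z_def by blast
    obtain z where z: "z \<in> Z" "f \<otimes> z \<in> S" using sup[OF ef(2)] unfolding Z_def by blast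
    define s where "s = e \<otimes> y"
    define t where "t = f \<otimes> z"
    have st: "s \<in> carrier G" "t \<in> carrier G" using ef y z Zc by (auto simp: s_def t_def)
    obtain u where u: "u \<in> Z" "inv s \<otimes> u \<in> S" using sup[of "inv s"] st unfolding Z_def by blast
    obtain v where v: "v \<in> Z" "inv t \<otimes> v \<in> S" using sup[of "inv t"] st unfolding Z_def by blast
    have cc: "c \<in> carrier G" "y \<in> carrier G" "z \<in> carrier G" "u \<in> carrier G" "v \<in> carrier G"
      using c C y z u v Zc by auto
    have "u \<in> S" using mult_closedD[OF S y(2)[folded s_def] u(2)] st cc by (simp add: m_assoc[symmetric])
    moreover have "v \<in> S" using mult_closedD[OF S z(2)[folded t_def] v(2)] st cc by (simp add: m_assoc[symmetric])
    moreover have "s \<otimes> t = c \<otimes> (t \<otimes> s)"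
    proof -
      have "e \<otimes> f = c \<otimes> (f \<otimes> e)" unfolding ef(3) using ef(1,2) by (simp add: m_assoc inv_mult_cancel)
      have "s \<otimes> t = e \<otimes> (y \<otimes> f) \<otimes> z" unfolding s_def t_def using ef cc by (simp add: m_assoc)
      also have "\<dots> = (e \<otimes> f) \<otimes> (y \<otimes> z)" using Zcent[OF y(1) ef(2)] ef(1,2) cc by (simp add: m_assoc)
      also have "\<dots> = c \<otimes> f \<otimes> (e \<otimes> (y \<otimes> z))" unfolding \<open>e \<otimes> f = c \<otimes> (f \<otimes> e)\<close> using ef(1,2) cc by (simp add: m_assoc)
      also have "e \<otimes> (y \<otimes> z) = e \<otimes> y \<otimes> z" using ef(1,2) cc by (simp add: m_assoc)
      also have "\<dots> = z \<otimes> (e \<otimes> y)" using Zcent[OF z(1), of "e \<otimes> y"] ef(1,2) cc by simp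
      finally show ?thesis unfolding s_def t_def using ef(1,2) cc by (simp add: m_assoc)
    qed
    ultimately show ?thesis using y(2) z(2) u v unfolding T_def s_def t_def by blast
  qed
  have word: "c [^] (n * n) \<otimes> u [^] n \<otimes> v [^] n \<in> T"
    if "s \<in> S" "t \<in> S" "inv s \<otimes> u \<in> S" "inv t \<otimes> v \<in> S" "u \<in> T" "v \<in> T" "s \<otimes> t = c \<otimes> (t \<otimes> s)"
      "c \<in> Z" "n > 0" for s t u v c and n :: nat
  proof -
    have "s \<in> carrier G" "t \<in> carrier G" using that mult_closed_carrier[OF S] by auto
    then have "s [^] n \<otimes> t [^] n \<otimes> (inv s \<otimes> u) [^] n \<otimes> (inv t \<otimes> v) [^] n = c [^] (n * n) \<otimes> u [^] n \<otimes> v [^] n"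
      using that Zc Zcent unfolding T_def by (intro commutator_word_pow) auto
    moreover have "s [^] n \<otimes> t [^] n \<otimes> (inv s \<otimes> u) [^] n \<otimes> (inv t \<otimes> v) [^] n \<in> S"
      using that mult_closed_pow[OF S] mult_closedD[OF S] by simp
    ultimately show ?thesis using that unfolding T_def by (auto intro: mZ Zpow)
  qed
  have inv_T: "inv t \<in> T" if t: "t \<in> T" for t
  proof (rule ccontr)
    assume nt: "inv t \<notin> T"
    have tZ: "t \<in> Z" using t by (simp add: T_def)
    obtain \<phi> where \<phi>: "real_hom A \<phi>" "\<And>x. x \<in> T \<Longrightarrow> \<phi> x \<ge> 0" "\<exists>x\<in>carrier A. \<phi> x \<noteq> 0"
      using A.exists_real_hom_nonneg[OF C(1) _ genA TA t] nt invA[OF tZ] CZ unfolding A_def by auto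
    have add: "\<phi> (x \<otimes> y) = \<phi> x + \<phi> y" if "x \<in> Z" "y \<in> Z" for x y
      using \<phi>(1) that by (simp add: real_hom_def A_def)
    have pow: "\<phi> (x [^] n) = real n * \<phi> x" if "x \<in> Z" for x and n :: nat
      using A.real_hom_pow[OF \<phi>(1), of x n] that nat_pow_consistent[of x n Z] by (simp add: A_def)
    have "\<phi> c = 0" if c: "c \<in> C" for c
    proof -
      obtain s t u v where *: "s \<in> S" "t \<in> S" "inv s \<otimes> u \<in> S" "inv t \<otimes> v \<in> S" "u \<in> T" "v \<in> T"
        "s \<otimes> t = c \<otimes> (t \<otimes> s)" using lift[OF c] by blast
      have cZ: "c \<in> Z" and uv: "u \<in> Z" "v \<in> Z" using c CZ * by (auto simp: T_def)
      have st: "s \<in> carrier G" "t \<in> carrier G" using * mult_closed_carrier[OF S] by auto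
      \<comment> \<open>Exchanging \<open>s\<close> with \<open>t\<close> and \<open>u\<close> with
        \<open>v\<close> replaces \<open>c\<close> by its inverse, which bounds
        \<open>\<phi> c\<close> from the other side.\<close>
      have "t \<otimes> s = inv c \<otimes> (s \<otimes> t)" unfolding *(7) using st Zc[OF cZ] by (simp add: m_assoc[symmetric])
      note ** = word[OF *(2,1,4,3,6,5) this invZ[OF cZ]] and *** = word[OF * cZ]
      have \<phi>ic: "\<phi> (inv c) = - \<phi> c" using A.real_hom_inv[OF \<phi>(1), of c] invA[OF cZ] cZ by (simp add: A_def)
      have a: "\<phi> (x [^] (n * n) \<otimes> y [^] n \<otimes> z [^] n) = real n * (real n * \<phi> x + (\<phi> y + \<phi> z))"
        if "x \<in> Z" "y \<in> Z" "z \<in> Z" for x y z and n :: nat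
        using that by (simp add: add mZ Zpow pow algebra_simps)
      show ?thesis
      proof (rule linear_dominates_imp_zero)
        fix n :: nat assume n: "n > 0"
        show "real n * \<phi> c + (\<phi> u + \<phi> v) \<ge> 0"
          using \<phi>(2)[OF ***[OF n]] a[OF cZ uv] n by (simp add: zero_le_mult_iff)
        show "- (real n * \<phi> c) + (\<phi> u + \<phi> v) \<ge> 0"
          using \<phi>(2)[OF **[OF n]] a[OF invZ[OF cZ] uv(2,1)] n \<phi>ic by (simp add: zero_le_mult_iff add.commute)
      qed
    qed
    then have "\<phi> x = 0" if "x \<in> carrier A" for x
      using A.real_hom_eq_zero_generate[OF \<phi>(1), of C x] genA that CZ unfolding A_def by simp
    then show False using \<phi>(3) by blast
  qed
  \<comment> \<open>Now that \<open>T\<close> is closed under inverses, the errors can be removed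
    from the word with \<open>n = 1\<close>.\<close>
  have CT: "c \<in> T" if c: "c \<in> C" for c
  proof -
    obtain s t u v where *: "s \<in> S" "t \<in> S" "inv s \<otimes> u \<in> S" "inv t \<otimes> v \<in> S" "u \<in> T" "v \<in> T"
        "s \<otimes> t = c \<otimes> (t \<otimes> s)" using lift[OF c] by blast
    have cZ: "c \<in> Z" using c CZ by auto
    have cc: "c \<in> carrier G" "u \<in> carrier G" "v \<in> carrier G" using cZ * Zc by (auto simp: T_def)
    have "c \<otimes> u \<otimes> v \<in> T" using word[OF * cZ, of 1] cc by simp
    then have "c \<otimes> u \<otimes> v \<otimes> inv v \<otimes> inv u \<in> T"
      using inv_T * mult_closedD[OF TA] by (simp add: A_def)
    then show ?thesis using cc by (simp add: m_assoc)
  qed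
  obtain z0 where "z0 \<in> T" using sup[of \<one>] C(2) generate_in_carrier[OF C(2)] unfolding T_def Z_def by auto
  then have "z0 \<otimes> inv z0 \<in> T" using inv_T mult_closedD[OF TA, of z0 "inv z0"] by (simp add: A_def)
  then have oneT: "\<one> \<in> T" using \<open>z0 \<in> T\<close> Zc by (simp add: T_def)
  have "subgroup T G"
    using oneT inv_T TA Zc by (intro subgroupI) (auto simp: T_def mult_closed_def A_def)
  then have ZT: "Z \<subseteq> T" unfolding Z_def using generate_subgroup_incl CT by blast
  have "g \<in> S" if g: "g \<in> carrier G" for g
  proof -
    obtain z where z: "z \<in> Z" "g \<otimes> z \<in> S" using sup[OF g] unfolding Z_def by blast
    have "(g \<otimes> z) \<otimes> inv z \<in> S" using mult_closedD[OF S z(2)] ZT invZ[OF z(1)] by (auto simp: T_def)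
    then show ?thesis using g Zc[OF z(1)] by (simp add: m_assoc)
  qed
  then show ?thesis using S by (auto simp: mult_closed_def)
qed

section \<open>Subsemigroups of nilpotent groups\<close>

declare lower_central.simps(2) [simp del]

lemma (in group) commutator_eq_one_iff:
  assumes "x \<in> carrier G" "y \<in> carrier G"
  shows "commutator G x y = \<one> \<longleftrightarrow> x \<otimes> y = y \<otimes> x"
proof -
  have "commutator G x y = (x \<otimes> y) \<otimes> inv (y \<otimes> x)"
    using assms by (simp add: inv_mult_group m_assoc)
  then show ?thesis using assms by (metis inv_closed inv_comm inv_equality inv_inv m_closed r_inv)
qed

lemma (in group_hom) hom_commutator:
  assumes "x \<in> carrier G" "y \<in> carrier G"
  shows "h (commutator G x y) = commutator H (h x) (h y)"
  using assms by simp

section \<open>Commutators and cosets of a normal subgroup\<close>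

lemma (in normal) factor_group_hom: "group_hom G (G Mod H) ((#>) H)"
  using factorgroup_is_group r_coset_hom_Mod is_group
  by (intro group_hom.intro) (auto simp: group_hom_axioms_def)

lemma (in normal) coset_eq_one_iff:
  assumes "x \<in> carrier G"
  shows "H #> x = H \<longleftrightarrow> x \<in> H"
  using rcos_self[OF assms subgroup_axioms] coset_join2[OF assms subgroup_axioms] by auto

lemma (in normal) coset_commute_iff:
  assumes "x \<in> carrier G" "y \<in> carrier G"
  shows "commutator G x y \<in> H \<longleftrightarrow> (H #> x) \<otimes>\<^bsub>G Mod H\<^esub> (H #> y) = (H #> y) \<otimes>\<^bsub>G Mod H\<^esub> (H #> x)"
proof -
  interpret h: group_hom G "G Mod H" "(#>) H" by (rule factor_group_hom)
  have "commutator G x y \<in> H \<longleftrightarrow> commutator (G Mod H) (H #> x) (H #> y) = \<one>\<^bsub>G Mod H\<^esub>"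
    using coset_eq_one_iff[of "commutator G x y"] assms
    by (simp add: h.hom_commutator[symmetric] del: h.hom_mult h.hom_inv mult_FactGroup)
  then show ?thesis using h.H.commutator_eq_one_iff[OF h.hom_closed h.hom_closed, OF assms] by simp
qed

lemma (in normal) coset_eqD:
  assumes "x \<in> carrier G" "y \<in> carrier G" "H #> x = H #> y"
  shows "inv x \<otimes> y \<in> H"
proof -
  interpret h: group_hom G "G Mod H" "(#>) H" by (rule factor_group_hom)
  have "H #> (inv x \<otimes> y) = \<one>\<^bsub>G Mod H\<^esub>"
    using assms h.hom_mult[of "inv x" y] h.hom_inv[of x] h.H.l_inv[OF h.hom_closed[OF assms(1)]] by simp
  then show ?thesis using coset_eq_one_iff[of "inv x \<otimes> y"] assms by simp
qed

text \<open>Centralisers in the quotient by \<open>H\<close> are subgroups, so commutation passes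
  from \<open>X\<close> and \<open>Y\<close> to the groups they generate, one argument at a
  time.\<close>

lemma (in normal) commutator_generate_mem:
  assumes "X \<subseteq> carrier G" "Y \<subseteq> carrier G" "\<And>x y. x \<in> X \<Longrightarrow> y \<in> Y \<Longrightarrow> commutator G x y \<in> H"
    and "x \<in> generate G X" "y \<in> generate G Y"
  shows "commutator G x y \<in> H"
proof -
  interpret h: group_hom G "G Mod H" "(#>) H" by (rule factor_group_hom)
  let ?h = "(#>) H" and ?Q = "G Mod H"
  have xc: "x \<in> carrier G" and yc: "y \<in> carrier G" using assms generate_in_carrier by blast+
  have gen: "?h x \<in> generate ?Q (?h ` X)" "?h y \<in> generate ?Q (?h ` Y)"
    using h.generate_img assms by blast+
  have sub: "?h ` X \<subseteq> carrier ?Q" "?h ` Y \<subseteq> carrier ?Q" using assms(1,2) h.hom_closed by blast+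
  have 1: "?h x \<otimes>\<^bsub>?Q\<^esub> ?h b = ?h b \<otimes>\<^bsub>?Q\<^esub> ?h x" if b: "b \<in> Y" for b
  proof (rule h.H.commute_generate[OF sub(1) _ _ gen(1)])
    show "?h b \<in> carrier ?Q" using b sub(2) by blast
    fix q assume "q \<in> ?h ` X"
    then obtain a where "a \<in> X" "q = ?h a" by blast
    then show "q \<otimes>\<^bsub>?Q\<^esub> ?h b = ?h b \<otimes>\<^bsub>?Q\<^esub> q"
      using coset_commute_iff[of a b] assms b by blast
  qed
  have "?h y \<otimes>\<^bsub>?Q\<^esub> ?h x = ?h x \<otimes>\<^bsub>?Q\<^esub> ?h y"
  proof (rule h.H.commute_generate[OF sub(2) _ _ gen(2)])
    show "?h x \<in> carrier ?Q" using xc h.hom_closed by blast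
    fix q assume "q \<in> ?h ` Y"
    then show "q \<otimes>\<^bsub>?Q\<^esub> ?h x = ?h x \<otimes>\<^bsub>?Q\<^esub> q" using 1 by (metis imageE)
  qed
  then show ?thesis using coset_commute_iff[OF xc yc] by (simp del: mult_FactGroup)
qed

section \<open>The lower central series and its generators\<close>

lemma (in group) lower_central_normal: "lower_central G n \<lhd> G"
proof (induction n)
  case 0
  then show ?case by (simp add: normal_inv_iff subgroup_self)
next
  case (Suc n)
  interpret N: normal "lower_central G n" G by fact
  show ?case unfolding lower_central.simps(2)
  proof (rule normal_generateI)
    show "{commutator G x y |x y. x \<in> lower_central G n \<and> y \<in> carrier G} \<subseteq> carrier G"
      using N.subset by auto
    fix h g assume "h \<in> {commutator G x y |x y. x \<in> lower_central G n \<and> y \<in> carrier G}"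
      and g: "g \<in> carrier G"
    then obtain x y where h: "h = commutator G x y" "x \<in> lower_central G n" "y \<in> carrier G" by blast
    have x: "x \<in> carrier G" using h N.subset by blast
    have "g \<otimes> h \<otimes> inv g = commutator G (g \<otimes> x \<otimes> inv g) (g \<otimes> y \<otimes> inv g)"
      unfolding h(1) using x h(3) g by (simp add: inv_mult_group m_assoc inv_mult_cancel)
    moreover have "g \<otimes> x \<otimes> inv g \<in> lower_central G n" using N.inv_op_closed2[OF g h(2)] .
    ultimately show "g \<otimes> h \<otimes> inv g \<in> {commutator G x y |x y. x \<in> lower_central G n \<and> y \<in> carrier G}"
      using h(3) g by blast
  qed
qed

lemma (in group) lower_central_subset: "lower_central G n \<subseteq> carrier G"
  using normal.axioms(1)[OF lower_central_normal] subgroup.subset by blast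

lemma (in group) lower_central_commutator:
  "x \<in> lower_central G n \<Longrightarrow> y \<in> carrier G \<Longrightarrow> commutator G x y \<in> lower_central G (Suc n)"
  unfolding lower_central.simps(2) by (rule generate.incl) blast

lemma (in group) lower_central_Suc_subset: "lower_central G (Suc n) \<subseteq> lower_central G n"
  unfolding lower_central.simps(2)
proof (rule generate_subgroup_incl)
  interpret N: normal "lower_central G n" G by (rule lower_central_normal)
  show "subgroup (lower_central G n) G" by (rule N.subgroup_axioms)
  show "{commutator G x y |x y. x \<in> lower_central G n \<and> y \<in> carrier G} \<subseteq> lower_central G n"
  proof clarify
    fix x y assume xy: "x \<in> lower_central G n" "y \<in> carrier G"
    have x: "x \<in> carrier G" using xy N.subset by blast
    have "x \<otimes> (y \<otimes> inv x \<otimes> inv y) \<in> lower_central G n"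
      using N.inv_op_closed2[OF xy(2), of "inv x"] xy(1) by auto
    then show "commutator G x y \<in> lower_central G n" using x xy(2) by (simp add: m_assoc)
  qed
qed

text \<open>Left-normed commutators of weight \<open>n + 1\<close> in elements of \<open>F\<close>,
  not the basic commutators of Hall's collection process. The index matches that of
  \<open>lower_central\<close>, which starts at 0.\<close>

primrec basic_commutators :: "('a, 'b) monoid_scheme \<Rightarrow> 'a set \<Rightarrow> nat \<Rightarrow> 'a set" where
  "basic_commutators G F 0 = F"
| "basic_commutators G F (Suc n) = (\<lambda>(e, f). commutator G e f) ` (basic_commutators G F n \<times> F)"

lemma finite_basic_commutators: "finite F \<Longrightarrow> finite (basic_commutators G F n)"
  by (induction n) auto

lemma (in group) basic_commutators_subset:
  assumes "F \<subseteq> carrier G"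
  shows "basic_commutators G F n \<subseteq> lower_central G n"
proof (induction n)
  case (Suc n)
  show ?case
  proof
    fix x assume "x \<in> basic_commutators G F (Suc n)"
    then obtain e f where "e \<in> basic_commutators G F n" "f \<in> F" "x = commutator G e f" by auto
    then show "x \<in> lower_central G (Suc n)" using Suc assms lower_central_commutator[of e n f] by blast
  qed
qed (use assms in simp)

text \<open>For finite \<open>F\<close> this makes each layer finitely generated modulo the next, as
  Hoelder's argument requires, and moreover by commutators, on which the quadratic growth
  acts.\<close>

lemma (in group) lower_central_generators:
  assumes F: "F \<subseteq> carrier G" "generate G F = carrier G"
  shows "lower_central G n \<subseteq> generate G (basic_commutators G F n \<union> lower_central G (Suc n))"
proof (induction n)
  case 0
  have "generate G F \<subseteq> generate G (F \<union> lower_central G (Suc 0))" by (rule mono_generate) blast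
  then show ?case using F(2) by simp
next
  case (Suc n)
  let ?K = "basic_commutators G F (Suc n) \<union> lower_central G (Suc (Suc n))"
  define L where "L = generate G ?K"
  have KS: "?K \<subseteq> lower_central G (Suc n)"
    using basic_commutators_subset[OF F(1)] lower_central_Suc_subset by blast
  have Kc: "?K \<subseteq> carrier G" using KS lower_central_subset by blast
  have LS: "L \<subseteq> lower_central G (Suc n)" unfolding L_def
    using generate_subgroup_incl[OF KS] lower_central_normal normal.axioms(1) by blast
  have sL: "subgroup L G" unfolding L_def using generate_is_subgroup[OF Kc] .
  have KL: "?K \<subseteq> L" unfolding L_def by (auto intro: generate.incl)
  \<comment> \<open>A subgroup between consecutive terms of the series is normal: the conjugate of
    \<open>l\<close> by \<open>g\<close> is the inverse of the commutator of \<open>l\<close> and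
    \<open>g\<close> times \<open>l\<close>, and that commutator lies in the lower term.\<close>
  have "g \<otimes> l \<otimes> inv g \<in> L" if g: "g \<in> carrier G" and l: "l \<in> L" for g l
  proof -
    have lc: "l \<in> carrier G" using sL l subgroup.subset by blast
    have "commutator G l g \<in> lower_central G (Suc (Suc n))"
      using lower_central_commutator l LS g by blast
    then have "commutator G l g \<in> L" using KL by blast
    then have "inv (commutator G l g) \<otimes> l \<in> L"
      using subgroup.m_closed[OF sL subgroup.m_inv_closed[OF sL] l] by blast
    then show ?thesis using g lc by (simp add: inv_mult_group m_assoc)
  qed
  then interpret L: normal L G using normal_inv_iff sL by blast
  have "commutator G x y \<in> L" if xy: "x \<in> lower_central G n" "y \<in> carrier G" for x y
  proof (rule L.commutator_generate_mem)
    show "basic_commutators G F n \<union> lower_central G (Suc n) \<subseteq> carrier G"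
      using basic_commutators_subset[OF F(1)] lower_central_subset by blast
    show "F \<subseteq> carrier G" by fact
    show "x \<in> generate G (basic_commutators G F n \<union> lower_central G (Suc n))" using xy Suc by blast
    show "y \<in> generate G F" using xy F by simp
    fix a b assume "a \<in> basic_commutators G F n \<union> lower_central G (Suc n)" "b \<in> F"
    then have "commutator G a b \<in> ?K"
      using lower_central_commutator[of a "Suc n" b] F(1)
      by auto
    then show "commutator G a b \<in> L" using KL by blast
  qed
  then have "lower_central G (Suc n) \<subseteq> L"
    unfolding lower_central.simps(2) by (intro generate_subgroup_incl[OF _ sL]) blast
  then show ?case unfolding L_def .
qed

lemma (in group_hom) mult_closed_image: "mult_closed G S \<Longrightarrow> mult_closed H (h ` S)"
  unfolding mult_closed_def by (auto simp: image_iff subset_iff simp flip: hom_mult)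

text \<open>By induction \<open>S\<close> meets every coset of each
  \<open>lower_central G (Suc i)\<close>. The hypothesis \<open>no_hom\<close> is consumed at the
  abelianisation; every further quotient is a central extension of one that the image of
  \<open>S\<close> already fills.\<close>

theorem (in group) semigroup_eq_carrier:
  assumes F: "finite F" "F \<subseteq> carrier G" "generate G F = carrier G"
    and S: "mult_closed G S" "S \<noteq> {}" "generate G S = carrier G"
    and no_hom: "\<And>\<phi> x. real_hom G \<phi> \<Longrightarrow> \<forall>s\<in>S. 0 \<le> \<phi> s \<Longrightarrow> x \<in> carrier G \<Longrightarrow> \<phi> x = 0"
    and nil: "lower_central G c = {\<one>}"
  shows "S = carrier G"
proof -
  have Sc: "S \<subseteq> carrier G" using S by (simp add: mult_closed_def)
  have lift: "\<exists>n\<in>N. g \<otimes> n \<in> S" if N: "N \<lhd> G" and g: "g \<in> carrier G" and im: "(#>) N ` S = carrier (G Mod N)" for N g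
  proof -
    interpret N: normal N G by fact
    have "N #> g \<in> (#>) N ` S" unfolding im using g by (auto simp: carrier_FactGroup)
    then obtain s where s: "s \<in> S" "N #> g = N #> s" by blast
    have sc: "s \<in> carrier G" using s Sc by blast
    have "inv g \<otimes> s \<in> N" using N.coset_eqD[OF g sc s(2)] .
    moreover have "g \<otimes> (inv g \<otimes> s) \<in> S" using s sc g by (simp add: inv_mult_cancel)
    ultimately show ?thesis by blast
  qed
  have "\<forall>g\<in>carrier G. \<exists>n\<in>lower_central G (Suc i). g \<otimes> n \<in> S" for i
  proof (induction i)
    case 0
    let ?N = "lower_central G (Suc 0)"
    interpret N: normal ?N G by (rule lower_central_normal)
    interpret h: group_hom G "G Mod ?N" "(#>) ?N" by (rule N.factor_group_hom)
    interpret Q: comm_group "G Mod ?N"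
    proof (rule h.H.group_comm_groupI)
      fix p q assume "p \<in> carrier (G Mod ?N)" "q \<in> carrier (G Mod ?N)"
      then obtain x y where "x \<in> carrier G" "y \<in> carrier G" "p = ?N #> x" "q = ?N #> y"
        by (auto simp: carrier_FactGroup)
      then show "p \<otimes>\<^bsub>G Mod ?N\<^esub> q = q \<otimes>\<^bsub>G Mod ?N\<^esub> p"
        using N.coset_commute_iff[of x y] lower_central_commutator[of x 0 y]
        by (simp del: mult_FactGroup)
    qed
    let ?T = "(#>) ?N ` S" and ?Q = "G Mod ?N"
    have T: "mult_closed ?Q ?T" using h.mult_closed_image S by blast
    have img: "(#>) ?N ` carrier G = carrier ?Q" by (auto simp: carrier_FactGroup)
    \<comment> \<open>An element of \<open>?T\<close> without inverse in \<open>?T\<close> would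
      yield a nonzero functional on the abelianisation, whose pullback contradicts
      \<open>no_hom\<close>. So \<open>?T\<close> is a subgroup, and it generates the
      quotient.\<close>
    have inv_T: "inv\<^bsub>?Q\<^esub> t \<in> ?T" if t: "t \<in> ?T" for t
    proof (rule ccontr)
      assume nt: "inv\<^bsub>?Q\<^esub> t \<notin> ?T"
      have fin: "finite ((#>) ?N ` F)" "(#>) ?N ` F \<subseteq> carrier ?Q" "generate ?Q ((#>) ?N ` F) = carrier ?Q"
        using F h.generate_img[OF F(2)] img by auto
      obtain \<phi> where \<phi>: "real_hom ?Q \<phi>" "\<And>x. x \<in> ?T \<Longrightarrow> \<phi> x \<ge> 0" "\<exists>x\<in>carrier ?Q. \<phi> x \<noteq> 0"
        using Q.exists_real_hom_nonneg[OF fin T t nt] by blast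
      have "real_hom G (\<lambda>x. \<phi> (?N #> x))"
        unfolding real_hom_def
      proof (intro ballI)
        fix x y assume xy: "x \<in> carrier G" "y \<in> carrier G"
        have "\<phi> ((?N #> x) \<otimes>\<^bsub>?Q\<^esub> (?N #> y)) = \<phi> (?N #> x) + \<phi> (?N #> y)"
          using \<phi>(1) h.hom_closed xy unfolding real_hom_def by blast
        then show "\<phi> (?N #> (x \<otimes> y)) = \<phi> (?N #> x) + \<phi> (?N #> y)"
          using h.hom_mult[OF xy] by simp
      qed
      then have "\<phi> (?N #> x) = 0" if "x \<in> carrier G" for x
        using no_hom[of "\<lambda>x. \<phi> (?N #> x)" x] \<phi>(2) that by blast
      then show False using \<phi>(3) img by (metis imageE)
    qed
    have "subgroup ?T ?Q"
      using T S(2) inv_T by (intro h.H.subgroupI) (auto simp: mult_closed_def)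
    then have "generate ?Q ?T \<subseteq> ?T" by (intro h.H.generate_subgroup_incl) auto
    moreover have "generate ?Q ?T = carrier ?Q" using h.generate_img[OF Sc] S(3) img by simp
    ultimately have "?T = carrier ?Q" using T by (auto simp: mult_closed_def)
    then show ?case using lift[OF lower_central_normal] by blast
  next
    case (Suc i)
    let ?N = "lower_central G (Suc (Suc i))" and ?E = "basic_commutators G F (Suc i)"
    let ?Q = "G Mod ?N" and ?h = "(#>) ?N"
    interpret N: normal ?N G by (rule lower_central_normal)
    interpret h: group_hom G ?Q ?h by (rule N.factor_group_hom)
    have E: "?E \<subseteq> lower_central G (Suc i)" using basic_commutators_subset F by blast
    have Ec: "?E \<subseteq> carrier G" using E lower_central_subset by blast
    have Cc: "?h ` ?E \<subseteq> carrier ?Q" using Ec h.hom_closed by blast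
    have "?h ` S = carrier ?Q"
    proof (rule h.H.semigroup_central_extension)
      show "finite (?h ` ?E)" using finite_basic_commutators[OF F(1)] by blast
      show "?h ` ?E \<subseteq> carrier ?Q" by fact
      show "mult_closed ?Q (?h ` S)" using h.mult_closed_image S by blast
      show "\<exists>e\<in>carrier ?Q. \<exists>f\<in>carrier ?Q. q = commutator ?Q e f" if q: "q \<in> ?h ` ?E" for q
      proof -
        obtain e f where ef: "e \<in> basic_commutators G F i" "f \<in> F" "q = ?h (commutator G e f)"
          using q by auto
        have c: "e \<in> carrier G" "f \<in> carrier G"
          using ef(1,2) F(2) basic_commutators_subset[OF F(2), of i] lower_central_subset[of i] by blast+
        show ?thesis using ef(3) h.hom_commutator[OF c] h.hom_closed c by metis
      qed
      show "q \<otimes>\<^bsub>?Q\<^esub> p = p \<otimes>\<^bsub>?Q\<^esub> q" if q: "q \<in> ?h ` ?E" "p \<in> carrier ?Q" for q p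
      proof -
        obtain x where x: "x \<in> ?E" "q = ?h x" using q by blast
        obtain y where y: "y \<in> carrier G" "p = ?h y" using q by (auto simp: carrier_FactGroup)
        have "commutator G x y \<in> ?N" using lower_central_commutator[of x "Suc i" y] x y E by blast
        then show ?thesis using N.coset_commute_iff[of x y] x y Ec by blast
      qed
      show "\<exists>z\<in>generate ?Q (?h ` ?E). p \<otimes>\<^bsub>?Q\<^esub> z \<in> ?h ` S" if p: "p \<in> carrier ?Q" for p
      proof -
        obtain g where g: "g \<in> carrier G" "p = ?h g" using p by (auto simp: carrier_FactGroup)
        obtain n where n: "n \<in> lower_central G (Suc i)" "g \<otimes> n \<in> S" using Suc g by blast
        have nc: "n \<in> carrier G" using n lower_central_subset by blast
        \<comment> \<open>Modulo \<open>?N\<close> the layer is generated by the image of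
          \<open>?E\<close>, so the correcting factor \<open>n\<close> from the induction hypothesis
          lands in the central subgroup over which the extension is taken.\<close>
        have "?h n \<in> ?h ` generate G (?E \<union> ?N)" using lower_central_generators[OF F(2,3), of "Suc i"] n by blast
        also have "\<dots> = generate ?Q (?h ` (?E \<union> ?N))"
          using h.generate_img[of "?E \<union> ?N"] Ec N.subset by blast
        also have "\<dots> \<subseteq> generate ?Q (?h ` ?E)"
        proof (rule h.H.generate_subgroup_incl)
          show "subgroup (generate ?Q (?h ` ?E)) ?Q" using h.H.generate_is_subgroup Cc by blast
          have "?h x = \<one>\<^bsub>?Q\<^esub>" if "x \<in> ?N" for x
            using N.coset_eq_one_iff[of x] that N.subset by auto
          then have "?h ` ?N \<subseteq> generate ?Q (?h ` ?E)"
            using generate.one[of ?Q "?h ` ?E"] by auto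
          moreover have "?h ` ?E \<subseteq> generate ?Q (?h ` ?E)" by (meson generate.incl subsetI)
          ultimately show "?h ` (?E \<union> ?N) \<subseteq> generate ?Q (?h ` ?E)" by (simp only: image_Un Un_least)
        qed
        finally have "?h n \<in> generate ?Q (?h ` ?E)" .
        moreover have "p \<otimes>\<^bsub>?Q\<^esub> ?h n \<in> ?h ` S" using h.hom_mult[OF g(1) nc] g n by (metis imageI)
        ultimately show ?thesis by blast
      qed
    qed
    then show ?case using lift[OF lower_central_normal] by blast
  qed
  moreover have "lower_central G (Suc c) \<subseteq> {\<one>}" using lower_central_Suc_subset[of c] nil by simp
  ultimately have "g \<in> S" if "g \<in> carrier G" for g using that by fastforce
  then show ?thesis using Sc by blast
qed

section \<open>The Hewitt--Savage zero-one law\<close>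

text \<open>This family of finite permutations suffices for the zero-one law:
  \<open>block_swap k\<close> carries an event about the first \<open>k\<close> coordinates to an
  independent copy about the next \<open>k\<close>.\<close>

definition block_swap :: "nat \<Rightarrow> (nat \<Rightarrow> 'a) \<Rightarrow> nat \<Rightarrow> 'a" where
  "block_swap k \<omega> i = (if i < k then \<omega> (i + k) else if i < 2 * k then \<omega> (i - k) else \<omega> i)"

context sequence_space
begin

lemma measurable_block_swap [measurable]: "block_swap k \<in> measurable S S"
proof (rule measurable_PiM_single')
  show "block_swap k \<in> space S \<rightarrow> (\<Pi>\<^sub>E i\<in>UNIV. space M)"
    by (auto simp: block_swap_def space_PiM PiE_iff)
  show "(\<lambda>\<omega>. block_swap k \<omega> i) \<in> measurable S M" for i
    unfolding block_swap_def by (cases "i < k"; cases "i < 2 * k") simp_all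
qed

lemma distr_block_swap: "distr S S (block_swap k) = S"
proof -
  define f where "f i = (if i < k then i + k else if i < 2 * k then i - k else i)" for i :: nat
  have "f (f i) = i" for i by (auto simp: f_def)
  then have "inj f" by (metis injI)
  then have *: "distr S S (\<lambda>\<omega>. \<lambda>n\<in>UNIV. \<omega> (f n)) = S"
    using distr_PiM_reindex[of UNIV "\<lambda>_. M" f UNIV] prob_space by simp
  have "(\<lambda>\<omega>. \<lambda>n\<in>UNIV. \<omega> (f n)) = (block_swap k :: (nat \<Rightarrow> 'a) \<Rightarrow> _)"
    by (auto simp: block_swap_def f_def fun_eq_iff)
  then show ?thesis using * by metis
qed

text \<open>Stated pointwise, which avoids a separate sigma-algebra of cylinders; measurability of
  \<open>B\<close> is carried alongside.\<close>

definition depends_below :: "nat \<Rightarrow> (nat \<Rightarrow> 'a) set \<Rightarrow> bool" where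
  "depends_below k B \<longleftrightarrow>
     (\<forall>\<omega>\<in>space S. \<forall>\<omega>'\<in>space S. (\<forall>i<k. \<omega> i = \<omega>' i) \<longrightarrow> (\<omega> \<in> B \<longleftrightarrow> \<omega>' \<in> B))"

lemma depends_belowI:
  "(\<And>\<omega> \<omega>'. \<omega> \<in> space S \<Longrightarrow> \<omega>' \<in> space S \<Longrightarrow> (\<And>i. i < k \<Longrightarrow> \<omega> i = \<omega>' i)
    \<Longrightarrow> \<omega> \<in> B \<longleftrightarrow> \<omega>' \<in> B) \<Longrightarrow> depends_below k B"
  unfolding depends_below_def by blast

lemma depends_belowD:
  "depends_below k B \<Longrightarrow> \<omega> \<in> space S \<Longrightarrow> \<omega>' \<in> space S \<Longrightarrow> (\<And>i. i < k \<Longrightarrow> \<omega> i = \<omega>' i)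
    \<Longrightarrow> \<omega> \<in> B \<longleftrightarrow> \<omega>' \<in> B"
  unfolding depends_below_def by blast

lemma depends_below_mono: "depends_below k B \<Longrightarrow> k \<le> l \<Longrightarrow> depends_below l B"
  unfolding depends_below_def by (meson order_less_le_trans)

text \<open>The approximable events form a sigma-algebra containing the one-coordinate events. A
  countable union is truncated at the cost of \<open>\<epsilon> / 2\<close>, and the other half is
  shared among the sets that remain.\<close>

lemma approx_depends_below:
  assumes "E \<in> sets S" "\<epsilon> > 0"
  shows "\<exists>k. \<exists>B\<in>sets S. depends_below k B \<and> measure S (sym_diff E B) < \<epsilon>"
proof -
  have "E \<in> sigma_sets (space S) {{\<omega>\<in>space S. \<omega> i \<in> A} | i A. A \<in> sets M}"
    using assms(1) unfolding sets_PiM_single space_PiM by simp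
  then show ?thesis using assms(2)
  proof (induction arbitrary: \<epsilon> rule: sigma_sets.induct)
    case (Basic E)
    then obtain i A where E: "E = {\<omega>\<in>space S. \<omega> i \<in> A}" "A \<in> sets M" by blast
    then have "E \<in> sets S" by simp
    moreover have "depends_below (Suc i) E" using E by (auto simp: depends_below_def)
    moreover have "measure S (sym_diff E E) < \<epsilon>" using Basic by simp
    ultimately show ?case by blast
  next
    case Empty
    have "depends_below 0 {}" by (simp add: depends_below_def)
    moreover have "measure S (sym_diff {} {}) < \<epsilon>" using Empty by simp
    ultimately show ?case by blast
  next
    case (Compl E)
    then obtain k B where B: "B \<in> sets S" "depends_below k B" "measure S (sym_diff E B) < \<epsilon>" by blast
    have "E \<in> sets S" using Compl(1) unfolding sets_PiM_single space_PiM by simp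
    then have "E \<subseteq> space S" by (rule sets.sets_into_space)
    then have "sym_diff (space S - E) (space S - B) = sym_diff E B"
      using sets.sets_into_space[OF B(1)] by blast
    moreover have "depends_below k (space S - B)"
    proof (rule depends_belowI)
      fix \<omega> \<omega>' assume *: "\<omega> \<in> space S" "\<omega>' \<in> space S" "\<And>i. i < k \<Longrightarrow> \<omega> i = \<omega>' i"
      then have "\<omega> \<in> B \<longleftrightarrow> \<omega>' \<in> B" by (rule depends_belowD[OF B(2)])
      then show "\<omega> \<in> space S - B \<longleftrightarrow> \<omega>' \<in> space S - B" using * by simp
    qed
    moreover have "space S - B \<in> sets S" using B(1) by simp
    ultimately show ?case using B(3) by (intro exI[of _ k] bexI[of _ "space S - B"]) simp_all
  next
    case (Union A)
    have meas: "A i \<in> sets S" for i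
      using Union(1)[of i] unfolding sets_PiM_single space_PiM by simp
    have "(\<lambda>n. measure S (\<Union>i<n. A i)) \<longlonglongrightarrow> measure S (\<Union>n. \<Union>i<n. A i)"
    proof (rule P.finite_Lim_measure_incseq)
      show "range (\<lambda>n. \<Union>i<n. A i) \<subseteq> sets S" using meas by auto
      show "incseq (\<lambda>n. \<Union>i<n. A i)" unfolding incseq_def by (intro allI impI UN_mono) auto
    qed
    moreover have "(\<Union>n. \<Union>i<n. A i) = (\<Union>i. A i)"
    proof
      show "(\<Union>i. A i) \<subseteq> (\<Union>n. \<Union>i<n. A i)"
      proof
        fix x assume "x \<in> (\<Union>i. A i)"
        then obtain i where "x \<in> A i" by blast
        then have "x \<in> (\<Union>j<Suc i. A j)" by auto
        then show "x \<in> (\<Union>n. \<Union>i<n. A i)" by blast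
      qed
    qed auto
    ultimately have "(\<lambda>n. measure S (\<Union>i<n. A i)) \<longlonglongrightarrow> measure S (\<Union>i. A i)" by simp
    then have "\<forall>\<^sub>F n in sequentially. measure S (\<Union>i. A i) - \<epsilon> / 2 < measure S (\<Union>i<n. A i)"
      using Union.prems by (intro order_tendstoD) auto
    then obtain n where n: "measure S (\<Union>i. A i) - \<epsilon> / 2 < measure S (\<Union>i<n. A i)"
      by (auto simp: eventually_sequentially)
    have n': "measure S ((\<Union>i. A i) - (\<Union>i<n. A i)) < \<epsilon> / 2"
      using n meas by (subst P.finite_measure_Diff) auto
    \<comment> \<open>\<open>Suc n\<close> rather than \<open>n\<close> keeps the tolerance positive
      when the truncated union is empty.\<close>
    define \<delta> where "\<delta> = \<epsilon> / (2 * real (Suc n))"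
    have "\<delta> > 0" using Union.prems by (simp add: \<delta>_def)
    then have "\<forall>i. \<exists>k. \<exists>B. B \<in> sets S \<and> depends_below k B \<and> measure S (sym_diff (A i) B) < \<delta>"
      using Union.IH by blast
    then obtain k B where kB: "\<And>i. B i \<in> sets S" "\<And>i. depends_below (k i) (B i)"
      "\<And>i. measure S (sym_diff (A i) (B i)) < \<delta>" by metis
    define K where "K = Max (k ` {..<Suc n})"
    have "depends_below K (B i)" if "i < n" for i
      using depends_below_mono[OF kB(2)[of i], of K] that unfolding K_def by simp
    note dep = this
    have 1: "depends_below K (\<Union>i<n. B i)"
    proof (rule depends_belowI)
      fix \<omega> \<omega>' assume *: "\<omega> \<in> space S" "\<omega>' \<in> space S" "\<And>i. i < K \<Longrightarrow> \<omega> i = \<omega>' i"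
      then have "\<omega> \<in> B j \<longleftrightarrow> \<omega>' \<in> B j" if "j < n" for j by (rule depends_belowD[OF dep[OF that]])
      then show "\<omega> \<in> (\<Union>i<n. B i) \<longleftrightarrow> \<omega>' \<in> (\<Union>i<n. B i)" by simp
    qed
    have "sym_diff (\<Union>i. A i) (\<Union>i<n. B i)
      \<subseteq> ((\<Union>i. A i) - (\<Union>i<n. A i)) \<union> (\<Union>i<n. sym_diff (A i) (B i))" by blast
    then have "measure S (sym_diff (\<Union>i. A i) (\<Union>i<n. B i))
      \<le> measure S (((\<Union>i. A i) - (\<Union>i<n. A i)) \<union> (\<Union>i<n. sym_diff (A i) (B i)))"
      using meas kB(1) by (intro P.finite_measure_mono) auto
    also have "\<dots> \<le> measure S ((\<Union>i. A i) - (\<Union>i<n. A i)) + measure S (\<Union>i<n. sym_diff (A i) (B i))"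
      using meas kB(1) by (intro measure_Un_le) auto
    also have "measure S (\<Union>i<n. sym_diff (A i) (B i)) \<le> (\<Sum>i<n. measure S (sym_diff (A i) (B i)))"
      using meas kB(1) by (intro measure_UNION_le) auto
    also have "\<dots> \<le> (\<Sum>i<n. \<delta>)" using kB(3) by (intro sum_mono) (simp add: less_imp_le)
    also have "\<dots> \<le> \<epsilon> / 2" using Union.prems by (simp add: \<delta>_def field_simps)
    finally have "measure S (sym_diff (\<Union>i. A i) (\<Union>i<n. B i)) < \<epsilon>" using n' by simp
    moreover have "(\<Union>i<n. B i) \<in> sets S" using kB(1) by auto
    ultimately show ?case using 1 by (intro exI[of _ K] bexI[of _ "\<Union>i<n. B i"]) simp_all
  qed
qed

lemma measurable_shift [measurable]: "(\<lambda>\<omega> i. \<omega> (i + k)) \<in> measurable S S"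
proof (rule measurable_PiM_single'[where f = "\<lambda>i \<omega>. \<omega> (i + k)" and N = S and M = "\<lambda>_. M" and I = UNIV])
  show "(\<lambda>\<omega>. \<omega> (i + k)) \<in> measurable S M" for i
    by (rule measurable_component_singleton) simp
  show "(\<lambda>\<omega> i. \<omega> (i + k)) \<in> space S \<rightarrow> (\<Pi>\<^sub>E i\<in>UNIV. space M)"
    by (rule funcsetI) (simp add: space_PiM PiE_UNIV_domain Pi_iff)
qed

text \<open>Splicing the first \<open>k\<close> coordinates of one sequence onto a second,
  independent one (\<open>comb_seq\<close>) has the law of a single sequence, and under it the
  intersection pulls back to the rectangle \<open>B \<times> A\<close>.\<close>

lemma measure_Int_shift:
  assumes B: "B \<in> sets S" "depends_below k B" and A: "A \<in> sets S"
  shows "measure S (B \<inter> {\<omega>\<in>space S. (\<lambda>i. \<omega> (i + k)) \<in> A}) = measure S B * measure S A"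
proof -
  let ?c = "\<lambda>(\<omega>, \<omega>'). comb_seq k \<omega> \<omega>'" and ?A = "{\<omega>\<in>space S. (\<lambda>i. \<omega> (i + k)) \<in> A}"
  have A': "?A \<in> sets S" using measurable_sets[OF measurable_shift A, of k] by (simp add: vimage_def Int_def conj_commute)
  have comb: "comb_seq k \<omega> \<omega>' \<in> space S" if "\<omega> \<in> space S" "\<omega>' \<in> space S" for \<omega> \<omega>'
    using that by (auto simp: space_PiM PiE_iff comb_seq_def)
  have "?c -` (B \<inter> ?A) \<inter> space (S \<Otimes>\<^sub>M S) = B \<times> A"
  proof -
    have cB: "comb_seq k \<omega> \<omega>' \<in> B \<longleftrightarrow> \<omega> \<in> B" if "\<omega> \<in> space S" "\<omega>' \<in> space S" for \<omega> \<omega>'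
      using depends_belowD[OF B(2) comb[OF that] that(1)] by (simp add: comb_seq_def)
    have cA: "comb_seq k \<omega> \<omega>' \<in> ?A \<longleftrightarrow> \<omega>' \<in> A" if "\<omega> \<in> space S" "\<omega>' \<in> space S" for \<omega> \<omega>'
    proof -
      have "(\<lambda>i. comb_seq k \<omega> \<omega>' (i + k)) = \<omega>'" by (simp add: comb_seq_def)
      then show ?thesis using comb[OF that] by simp
    qed
    show ?thesis
    proof (rule Set.set_eqI)
      fix p :: "(nat \<Rightarrow> 'a) \<times> (nat \<Rightarrow> 'a)"
      obtain \<omega> \<omega>' where p: "p = (\<omega>, \<omega>')" by fastforce
      show "p \<in> ?c -` (B \<inter> ?A) \<inter> space (S \<Otimes>\<^sub>M S) \<longleftrightarrow> p \<in> B \<times> A"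
      proof (cases "\<omega> \<in> space S \<and> \<omega>' \<in> space S")
        case True
        then show ?thesis using cA[of \<omega> \<omega>'] cB[of \<omega> \<omega>'] by (simp add: space_pair_measure p)
      next
        case False
        then show ?thesis using sets.sets_into_space[OF B(1)] sets.sets_into_space[OF A]
          by (auto simp: space_pair_measure p)
      qed
    qed
  qed
  then have "measure S (B \<inter> ?A) = measure (S \<Otimes>\<^sub>M S) (B \<times> A)"
    using measure_distr[OF measurable_comb_seq, of "B \<inter> ?A" M k] PiM_comb_seq[of k] B(1) A' by simp
  also have "\<dots> = measure S B * measure S A"
    using P.emeasure_pair_measure_Times[OF B(1) A]
    by (simp add: measure_def enn2real_mult)
  finally show ?thesis .
qed

text \<open>An event invariant under all block swaps is approximated both by an event \<open>B\<close> depending on the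
  first \<open>k\<close> coordinates and by its independent copy depending on the next \<open>k\<close> coordinates, so it
  is independent of itself.\<close>

theorem hewitt_savage:
  assumes E: "E \<in> sets S"
    and inv: "\<And>k \<omega>. \<omega> \<in> space S \<Longrightarrow> block_swap k \<omega> \<in> E \<longleftrightarrow> \<omega> \<in> E"
  shows "measure S E = 0 \<or> measure S E = 1"
proof -
  let ?p = "measure S E"
  \<comment> \<open>With \<open>q\<close> the probability of \<open>B\<close>, the number
    \<open>q * q\<close> is within \<open>2 * \<epsilon>\<close> of \<open>p\<close> by independence
    of the copy, and within \<open>2 * \<epsilon>\<close> of \<open>p * p\<close> because
    \<open>q\<close> is within \<open>\<epsilon>\<close> of \<open>p\<close>.\<close>
  have close: "\<bar>?p - ?p * ?p\<bar> \<le> 4 * \<epsilon>" if \<epsilon>: "\<epsilon> > 0" for \<epsilon>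
  proof -
    obtain k B where B: "B \<in> sets S" "depends_below k B" "measure S (sym_diff E B) < \<epsilon>"
      using approx_depends_below[OF E \<epsilon>] by blast
    define B' where "B' = {\<omega>\<in>space S. (\<lambda>i. \<omega> (i + k)) \<in> B}"
    have B': "B' \<in> sets S" using measurable_sets[OF measurable_shift B(1), of k]
      by (simp add: B'_def vimage_def Int_def conj_commute)
    have swap_B: "block_swap k \<omega> \<in> B \<longleftrightarrow> \<omega> \<in> B'" if "\<omega> \<in> space S" for \<omega>
    proof -
      have "block_swap k \<omega> \<in> space S" "(\<lambda>i. \<omega> (i + k)) \<in> space S"
        using that by (auto simp: space_PiM PiE_iff block_swap_def)
      then have "block_swap k \<omega> \<in> B \<longleftrightarrow> (\<lambda>i. \<omega> (i + k)) \<in> B"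
        by (rule depends_belowD[OF B(2)]) (simp add: block_swap_def)
      then show ?thesis using that by (simp add: B'_def)
    qed
    \<comment> \<open>Both \<open>E\<close> and the measure are invariant under the swap, so the
      copy \<open>B'\<close> is as close to \<open>E\<close> as \<open>B\<close> is.\<close>
    have "sym_diff E B' = block_swap k -` sym_diff E B \<inter> space S"
      using swap_B inv sets.sets_into_space[OF E] sets.sets_into_space[OF B'] by blast
    then have "measure S (sym_diff E B') = measure (distr S S (block_swap k)) (sym_diff E B)"
      using E B(1) by (subst measure_distr) auto
    then have eB': "measure S (sym_diff E B') < \<epsilon>" using B(3) distr_block_swap by simp
    have le: "measure S X \<le> measure S Y + measure S Z"
      if "X \<subseteq> Y \<union> Z" "Y \<in> sets S" "Z \<in> sets S" for X Y Z
    proof -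
      have "measure S X \<le> measure S (Y \<union> Z)" using that by (intro P.finite_measure_mono) auto
      also have "\<dots> \<le> measure S Y + measure S Z" using that by (intro measure_Un_le)
      finally show ?thesis .
    qed
    have m: "sym_diff E B \<in> sets S" "sym_diff E B' \<in> sets S" using E B(1) B' by auto
    have 1: "?p \<le> measure S B + \<epsilon>" using le[of E B "sym_diff E B"] B m by force
    have 2: "measure S B \<le> ?p + \<epsilon>" using le[of B E "sym_diff E B"] E B m by force
    have 3: "measure S (B \<inter> B') = measure S B * measure S B"
      unfolding B'_def using measure_Int_shift[OF B(1,2) B(1)] .
    have 4: "measure S (B \<inter> B') \<le> ?p + \<epsilon>"
      using le[of "B \<inter> B'" E "sym_diff E B"] E B m by force
    have "?p \<le> measure S ((B \<inter> B') \<union> sym_diff E B) + measure S (sym_diff E B')"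
      using B(1) B' m by (intro le) auto
    also have "measure S ((B \<inter> B') \<union> sym_diff E B) \<le> measure S (B \<inter> B') + measure S (sym_diff E B)"
      using B(1) B' m by (intro le) auto
    finally have 5: "?p \<le> measure S (B \<inter> B') + 2 * \<epsilon>" using B(3) eB' by simp
    let ?q = "measure S B"
    have "\<bar>?q * ?q - ?p * ?p\<bar> = \<bar>?q - ?p\<bar> * (?q + ?p)"
    proof -
      have "?q * ?q - ?p * ?p = (?q - ?p) * (?q + ?p)" by (simp add: algebra_simps)
      then show ?thesis by (simp add: abs_mult)
    qed
    also have "\<dots> \<le> \<epsilon> * 2"
    proof (rule mult_mono)
      show "?q + ?p \<le> 2" using P.prob_le_1[of E] P.prob_le_1[of B] by linarith
    qed (use 1 2 \<epsilon> in auto)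
    finally show ?thesis using 3 4 5 by linarith
  qed
  have "\<bar>?p - ?p * ?p\<bar> \<le> 0 + \<epsilon>" if "\<epsilon> > 0" for \<epsilon> using close[of "\<epsilon> / 4"] that by simp
  then have "\<bar>?p - ?p * ?p\<bar> \<le> 0" by (rule field_le_epsilon)
  then have "?p * (1 - ?p) = 0" by (simp add: algebra_simps)
  then show ?thesis by auto
qed

end

section \<open>Functionals that are eventually nonnegative along the walk\<close>

text \<open>The generators form a list so that rounding a functional on them yields an integer list.
  There are countably many of these, so almost sure statements may be quantified over them.\<close>

locale symmetric_walk = group +
  fixes \<mu> :: "'a pmf" and fs :: "'a list"
  assumes symmetric: "symmetric_measure G \<mu>"
    and generate_support: "generate G (set_pmf \<mu>) = carrier G"
    and fs_carrier: "set fs \<subseteq> carrier G"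
    and generate_fs: "generate G (set fs) = carrier G"

sublocale symmetric_walk \<subseteq> W: sequence_space "measure_pmf \<mu>"
  by unfold_locales

context symmetric_walk
begin

lemma space_S [simp]: "space W.S = UNIV"
  by (simp add: space_PiM)

lemma support_carrier: "x \<in> set_pmf \<mu> \<Longrightarrow> x \<in> carrier G"
  using symmetric by (auto simp: symmetric_measure_def)

text \<open>Confining events to \<open>paths\<close> leaves countably many initial segments of each
  length: the support of a pmf is countable, while the type \<open>'a\<close> may not be.\<close>

definition paths :: "(nat \<Rightarrow> 'a) set" where
  "paths = {\<omega>. \<forall>i. \<omega> i \<in> set_pmf \<mu>}"

lemma pathsD: "\<omega> \<in> paths \<Longrightarrow> \<omega> i \<in> set_pmf \<mu>"
  by (simp add: paths_def)

lemma paths_carrier: "\<omega> \<in> paths \<Longrightarrow> \<omega> i \<in> carrier G"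
  using support_carrier pathsD by blast

lemma rwalk_carrier: "\<omega> \<in> paths \<Longrightarrow> rwalk G \<omega> m \<in> carrier G"
  by (induction m) (simp_all add: paths_carrier)

lemma sets_coordinate: "{\<omega>. \<omega> i \<in> A} \<in> sets W.S"
proof -
  have "(\<lambda>\<omega>. \<omega> i) \<in> measurable W.S (measure_pmf \<mu>)" by (rule measurable_component_singleton) simp
  then have "(\<lambda>\<omega>. \<omega> i) -` A \<inter> space W.S \<in> sets W.S" by (rule measurable_sets) simp
  then show ?thesis by (simp add: vimage_def)
qed

lemma sets_paths: "paths \<in> sets W.S"
proof -
  have "paths = (\<Inter>i. {\<omega>. \<omega> i \<in> set_pmf \<mu>})" by (auto simp: paths_def)
  then show ?thesis using sets_coordinate by auto
qed

lemma AE_paths: "AE \<omega> in W.S. \<omega> \<in> paths"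
proof -
  have "AE \<omega> in W.S. \<omega> i \<in> set_pmf \<mu>" for i
    using W.AE_component[of i "\<lambda>x. x \<in> set_pmf \<mu>"] by (simp add: AE_measure_pmf)
  then have "AE \<omega> in W.S. \<forall>i. \<omega> i \<in> set_pmf \<mu>" by (simp add: AE_all_countable)
  then show ?thesis by (simp add: paths_def)
qed

text \<open>The event is a countable union of cylinders, one for each admissible word of length
  \<open>m\<close>. The predicate \<open>P\<close> may therefore quantify over uncountably many
  functionals.\<close>

lemma sets_finite_dependence:
  assumes dep: "\<And>\<omega> \<omega>'. \<omega> \<in> paths \<Longrightarrow> \<omega>' \<in> paths \<Longrightarrow> \<forall>i<m. \<omega> i = \<omega>' i \<Longrightarrow> P \<omega> \<Longrightarrow> P \<omega>'"
  shows "{\<omega>\<in>paths. P \<omega>} \<in> sets W.S"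
proof -
  define L where "L = {map \<omega> [0..<m] | \<omega>. \<omega> \<in> paths \<and> P \<omega>}"
  have "L \<subseteq> lists (set_pmf \<mu>)" by (auto simp: L_def dest: pathsD)
  then have "countable L" by (rule countable_subset) (rule countable_lists[OF countable_set_pmf])
  \<comment> \<open>The guarded index set \<open>{..m}\<close> keeps the intersection over a
    nonempty set even for \<open>m = 0\<close>.\<close>
  have "{\<omega>\<in>paths. P \<omega>} = paths \<inter> (\<Union>l\<in>L. \<Inter>i\<in>{..m}. {\<omega>. i < m \<longrightarrow> \<omega> i \<in> {l ! i}})"
  proof (intro equalityI subsetI)
    fix \<omega> assume "\<omega> \<in> {\<omega>\<in>paths. P \<omega>}"
    then have "\<omega> \<in> paths" "map \<omega> [0..<m] \<in> L" by (auto simp: L_def)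
    then show "\<omega> \<in> paths \<inter> (\<Union>l\<in>L. \<Inter>i\<in>{..m}. {\<omega>. i < m \<longrightarrow> \<omega> i \<in> {l ! i}})"
      by (intro IntI UN_I[of "map \<omega> [0..<m]"]) auto
  next
    fix \<omega> assume "\<omega> \<in> paths \<inter> (\<Union>l\<in>L. \<Inter>i\<in>{..m}. {\<omega>. i < m \<longrightarrow> \<omega> i \<in> {l ! i}})"
    then obtain l where l: "\<omega> \<in> paths" "l \<in> L" "\<forall>i<m. \<omega> i = l ! i" by auto
    obtain \<omega>' where w: "\<omega>' \<in> paths" "P \<omega>'" "l = map \<omega>' [0..<m]" using l(2) by (auto simp: L_def)
    have "\<forall>i<m. \<omega>' i = \<omega> i" using l(3) w(3) by simp
    then show "\<omega> \<in> {\<omega>\<in>paths. P \<omega>}" using dep[OF w(1) l(1) _ w(2)] l(1) by blast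
  qed
  moreover have "{\<omega>. i < m \<longrightarrow> \<omega> i \<in> {l ! i}} \<in> sets W.S" for i and l :: "'a list"
    using sets_coordinate[of i "{l ! i}"] sets.top[of W.S] by (cases "i < m") auto
  then have "(\<Inter>i\<in>{..m}. {\<omega>. i < m \<longrightarrow> \<omega> i \<in> {l ! i}}) \<in> sets W.S" for l :: "'a list"
    by (intro sets.finite_INT) auto
  ultimately show ?thesis
    using \<open>countable L\<close> sets_paths by (auto intro!: sets.Int sets.countable_UN')
qed

lemma rwalk_cong: "\<forall>i<m. \<omega> i = \<omega>' i \<Longrightarrow> rwalk G \<omega> m = rwalk G \<omega>' m"
  by (induction m) auto

lemma real_hom_rwalk:
  assumes "real_hom G \<phi>" "\<omega> \<in> paths"
  shows "\<phi> (rwalk G \<omega> m) = (\<Sum>i<m. \<phi> (\<omega> i))"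
proof (induction m)
  case 0
  then show ?case using real_hom_one[OF assms(1)] by simp
next
  case (Suc m)
  have "\<phi> (rwalk G \<omega> m \<otimes> \<omega> m) = \<phi> (rwalk G \<omega> m) + \<phi> (\<omega> m)"
    using assms rwalk_carrier paths_carrier unfolding real_hom_def by blast
  then show ?case using Suc by simp
qed

lemma block_swap_paths: "\<omega> \<in> paths \<Longrightarrow> block_swap k \<omega> \<in> paths"
  by (simp add: paths_def block_swap_def)

lemma block_swap_block_swap: "block_swap k (block_swap k \<omega>) = \<omega>"
  by (auto simp: block_swap_def fun_eq_iff)

lemma real_hom_rwalk_block_swap:
  assumes "real_hom G \<phi>" "\<omega> \<in> paths" "m \<ge> 2 * k"
  shows "\<phi> (rwalk G (block_swap k \<omega>) m) = \<phi> (rwalk G \<omega> m)"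
proof -
  define f where "f i = (if i < k then i + k else if i < 2 * k then i - k else i)" for i
  have "(\<Sum>i<m. \<phi> (block_swap k \<omega> i)) = (\<Sum>i<m. \<phi> (\<omega> i))"
    by (rule sum.reindex_bij_witness[of _ f f]) (use assms(3) in \<open>auto simp: f_def block_swap_def\<close>)
  then show ?thesis using real_hom_rwalk assms block_swap_paths by simp
qed

text \<open>Functionals are normalised to vanish outside the carrier, which makes the boxes below compact.\<close>

definition homs :: "('a \<Rightarrow> real) set" where
  "homs = {\<phi>. real_hom G \<phi> \<and> (\<forall>x. x \<notin> carrier G \<longrightarrow> \<phi> x = 0)}"

text \<open>For positive \<open>N\<close> the values on the generators lie within
  \<open>1 / N\<close> of the grid point \<open>z / N\<close>. The inequality is weak so that boxes
  are closed.\<close>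

definition hom_box :: "nat \<Rightarrow> int list \<Rightarrow> ('a \<Rightarrow> real) set" where
  "hom_box N z = {\<phi>\<in>homs. \<forall>i<length fs. \<bar>real N * \<phi> (fs ! i) - real_of_int (z ! i)\<bar> \<le> 1}"

lemma homs_hom: "\<phi> \<in> homs \<Longrightarrow> real_hom G \<phi>"
  by (simp add: homs_def)

text \<open>The constant \<open>b\<close> depends on \<open>x\<close> alone, as it comes from a word
  for \<open>x\<close> in the generators. Thus control on the generators gives uniform control at
  every point of the group.\<close>

lemma homs_bound:
  assumes "x \<in> carrier G"
  shows "\<exists>b\<ge>0. \<forall>\<phi>\<in>homs. \<forall>r\<ge>0. (\<forall>f\<in>set fs. \<bar>\<phi> f\<bar> \<le> r) \<longrightarrow> \<bar>\<phi> x\<bar> \<le> b * r"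
  using assms[folded generate_fs]
proof (induction x rule: generate.induct)
  case one
  have "\<forall>\<phi>\<in>homs. \<phi> \<one> = 0" using real_hom_one homs_hom by blast
  then show ?case by (intro exI[of _ 0]) auto
next
  case (incl h)
  then show ?case by (intro exI[of _ 1]) auto
next
  case (inv h)
  then have "\<forall>\<phi>\<in>homs. \<phi> (inv h) = - \<phi> h" using real_hom_inv homs_hom fs_carrier by blast
  then show ?case using inv by (intro exI[of _ 1]) auto
next
  case (eng g h)
  from eng.IH(1) obtain b where
    b: "b \<ge> 0" "\<forall>\<phi>\<in>homs. \<forall>r\<ge>0. (\<forall>f\<in>set fs. \<bar>\<phi> f\<bar> \<le> r) \<longrightarrow> \<bar>\<phi> g\<bar> \<le> b * r" by blast
  from eng.IH(2) obtain c where
    c: "c \<ge> 0" "\<forall>\<phi>\<in>homs. \<forall>r\<ge>0. (\<forall>f\<in>set fs. \<bar>\<phi> f\<bar> \<le> r) \<longrightarrow> \<bar>\<phi> h\<bar> \<le> c * r" by blast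
  have gh: "g \<in> carrier G" "h \<in> carrier G" using eng generate_fs by auto
  show ?case
  proof (intro exI[of _ "b + c"] conjI ballI allI impI)
    fix \<phi> and r :: real assume *: "\<phi> \<in> homs" "r \<ge> 0" "\<forall>f\<in>set fs. \<bar>\<phi> f\<bar> \<le> r"
    have "\<phi> (g \<otimes> h) = \<phi> g + \<phi> h" using homs_hom[OF *(1)] gh by (simp add: real_hom_def)
    moreover have "\<bar>\<phi> g\<bar> \<le> b * r" "\<bar>\<phi> h\<bar> \<le> c * r" using b(2) c(2) * by blast+
    ultimately show "\<bar>\<phi> (g \<otimes> h)\<bar> \<le> (b + c) * r" by (simp add: algebra_simps)
  qed (use b c in simp)
qed

text \<open>In the topology of pointwise convergence the box is a closed subset of a product of
  compact intervals, so Tychonoff's theorem applies.\<close>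

lemma compact_hom_box:
  assumes "N > 0"
  shows "compact (hom_box N z)"
proof -
  define r where "r = (\<Sum>i<length fs. \<bar>real_of_int (z ! i)\<bar> + 1)"
  have r0: "r \<ge> 0" unfolding r_def by (intro sum_nonneg) simp
  have r: "\<bar>\<phi> f\<bar> \<le> r" if \<phi>: "\<phi> \<in> hom_box N z" "f \<in> set fs" for \<phi> f
  proof -
    obtain i where i: "i < length fs" "f = fs ! i" using \<phi>(2) in_set_conv_nth[of f fs] by auto
    then have "\<bar>real N * \<phi> f - real_of_int (z ! i)\<bar> \<le> 1" using that by (simp add: hom_box_def)
    then have "\<bar>real N * \<phi> f\<bar> \<le> \<bar>real_of_int (z ! i)\<bar> + 1" by linarith
    moreover have "\<bar>\<phi> f\<bar> \<le> \<bar>real N * \<phi> f\<bar>" using assms by (simp add: abs_mult mult_le_cancel_right1)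
    moreover have "\<bar>real_of_int (z ! i)\<bar> + 1 \<le> r"
      unfolding r_def using i by (intro member_le_sum) auto
    ultimately show ?thesis by linarith
  qed
  have "\<exists>b. \<forall>\<phi>\<in>hom_box N z. \<bar>\<phi> x\<bar> \<le> b" for x
  proof (cases "x \<in> carrier G")
    case True
    then obtain b where "\<forall>\<phi>\<in>homs. \<forall>r\<ge>0. (\<forall>f\<in>set fs. \<bar>\<phi> f\<bar> \<le> r) \<longrightarrow> \<bar>\<phi> x\<bar> \<le> b * r"
      using homs_bound by blast
    then have "\<forall>\<phi>\<in>hom_box N z. \<bar>\<phi> x\<bar> \<le> b * r" using r r0 by (simp add: hom_box_def)
    then show ?thesis by blast
  next
    case False
    then have "\<forall>\<phi>\<in>hom_box N z. \<bar>\<phi> x\<bar> \<le> 0" by (simp add: hom_box_def homs_def)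
    then show ?thesis by blast
  qed
  then have "\<exists>b. \<forall>x. \<forall>\<phi>\<in>hom_box N z. \<bar>\<phi> x\<bar> \<le> b x" by (rule choice[OF allI])
  then obtain b where b: "\<And>x \<phi>. \<phi> \<in> hom_box N z \<Longrightarrow> \<bar>\<phi> x\<bar> \<le> b x" by blast
  let ?K = "PiE UNIV (\<lambda>x. {- b x..b x})"
  have "compactin (product_topology (\<lambda>_. euclidean) UNIV) ?K"
    unfolding compactin_PiE by (simp add: compactin_euclidean_iff)
  then have "compact ?K" by (simp add: euclidean_product_topology compactin_euclidean_iff)
  moreover have "closed (hom_box N z)"
  proof -
    have "hom_box N z = (\<Inter>x\<in>carrier G. \<Inter>y\<in>carrier G. {\<phi>. \<phi> (x \<otimes> y) = \<phi> x + \<phi> y})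
      \<inter> (\<Inter>x\<in>- carrier G. {\<phi>. \<phi> x = 0})
      \<inter> (\<Inter>i\<in>{..<length fs}. {\<phi>. \<bar>real N * \<phi> (fs ! i) - real_of_int (z ! i)\<bar> \<le> 1})"
      by (auto simp: hom_box_def homs_def real_hom_def)
    moreover have "closed {\<phi>::'a \<Rightarrow> real. \<phi> (x \<otimes> y) = \<phi> x + \<phi> y}" for x y
      by (intro closed_Collect_eq continuous_intros continuous_on_product_coordinates)
    moreover have "closed {\<phi>::'a \<Rightarrow> real. \<phi> x = 0}" for x
      by (intro closed_Collect_eq continuous_intros continuous_on_product_coordinates)
    moreover have "closed {\<phi>::'a \<Rightarrow> real. \<bar>real N * \<phi> (fs ! i) - real_of_int (z ! i)\<bar> \<le> 1}" for i
      by (intro closed_Collect_le continuous_intros continuous_on_product_coordinates)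
    ultimately show ?thesis by (simp add: closed_INT closed_Int)
  qed
  moreover have "hom_box N z \<subseteq> ?K"
  proof
    fix \<phi> assume "\<phi> \<in> hom_box N z"
    then have "- b x \<le> \<phi> x \<and> \<phi> x \<le> b x" for x using b[of \<phi> x] by linarith
    then show "\<phi> \<in> ?K" by (simp add: PiE_UNIV_domain)
  qed
  ultimately show ?thesis by (metis compact_Int_closed inf.absorb_iff2)
qed

text \<open>The functional may vary with the horizon \<open>M\<close>, so the event arises by
  countable operations from events about the first \<open>M\<close> increments. Asking for one
  functional at all times would leave an uncountable union.\<close>

definition pos_event :: "nat \<Rightarrow> int list \<Rightarrow> (nat \<Rightarrow> 'a) set" where
  "pos_event N z = {\<omega>\<in>paths. \<exists>n. \<forall>M. \<exists>\<phi>\<in>hom_box N z. \<forall>m\<in>{n..M}. 0 \<le> \<phi> (rwalk G \<omega> m)}"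

lemma sets_pos_event: "pos_event N z \<in> sets W.S"
proof -
  have "pos_event N z = (\<Union>n. \<Inter>M. {\<omega>\<in>paths. \<exists>\<phi>\<in>hom_box N z. \<forall>m\<in>{n..M}. 0 \<le> \<phi> (rwalk G \<omega> m)})"
    by (auto simp: pos_event_def)
  moreover have "{\<omega>\<in>paths. \<exists>\<phi>\<in>hom_box N z. \<forall>m\<in>{n..M}. 0 \<le> \<phi> (rwalk G \<omega> m)} \<in> sets W.S" for n M
  proof (rule sets_finite_dependence[of M])
    fix \<omega> \<omega>' assume *: "\<forall>i<M. \<omega> i = \<omega>' i" "\<exists>\<phi>\<in>hom_box N z. \<forall>m\<in>{n..M}. 0 \<le> \<phi> (rwalk G \<omega> m)"
    have "rwalk G \<omega> m = rwalk G \<omega>' m" if "m \<in> {n..M}" for m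
      using *(1) that by (intro rwalk_cong) auto
    then show "\<exists>\<phi>\<in>hom_box N z. \<forall>m\<in>{n..M}. 0 \<le> \<phi> (rwalk G \<omega>' m)" using *(2) by auto
  qed
  ultimately show ?thesis by auto
qed

text \<open>The conditions at the times \<open>m \<ge> n\<close> cut out closed subsets of a compact
  box, so solvability up to every horizon gives a common solution by the finite intersection
  property.\<close>

lemma pos_event_iff:
  assumes "N > 0" "\<omega> \<in> paths"
  shows "\<omega> \<in> pos_event N z \<longleftrightarrow> (\<exists>n. \<exists>\<phi>\<in>hom_box N z. \<forall>m\<ge>n. 0 \<le> \<phi> (rwalk G \<omega> m))"
proof
  assume "\<omega> \<in> pos_event N z"
  then obtain n where n: "\<And>M. \<exists>\<phi>\<in>hom_box N z. \<forall>m\<in>{n..M}. 0 \<le> \<phi> (rwalk G \<omega> m)"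
    by (auto simp: pos_event_def)
  have "hom_box N z \<inter> (\<Inter>m\<in>{n..}. {\<phi>. 0 \<le> \<phi> (rwalk G \<omega> m)}) \<noteq> {}"
  proof (rule compact_imp_fip_image[OF compact_hom_box[OF assms(1)]])
    show "closed {\<phi>::'a \<Rightarrow> real. 0 \<le> \<phi> (rwalk G \<omega> m)}" for m
      by (intro closed_Collect_le continuous_intros continuous_on_product_coordinates)
    fix I assume I: "finite I" "I \<subseteq> {n..}"
    \<comment> \<open>Inserting \<open>n\<close> gives the maximum a meaning for empty
      \<open>I\<close>.\<close>
    obtain \<phi> where \<phi>: "\<phi> \<in> hom_box N z" "\<forall>m\<in>{n..Max (insert n I)}. 0 \<le> \<phi> (rwalk G \<omega> m)"
      using n by blast
    have "0 \<le> \<phi> (rwalk G \<omega> m)" if "m \<in> I" for m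
      using \<phi>(2) I that by (auto simp: subset_iff)
    then show "hom_box N z \<inter> (\<Inter>m\<in>I. {\<phi>. 0 \<le> \<phi> (rwalk G \<omega> m)}) \<noteq> {}" using \<phi>(1) by blast
  qed
  then show "\<exists>n. \<exists>\<phi>\<in>hom_box N z. \<forall>m\<ge>n. 0 \<le> \<phi> (rwalk G \<omega> m)" by auto
next
  assume "\<exists>n. \<exists>\<phi>\<in>hom_box N z. \<forall>m\<ge>n. 0 \<le> \<phi> (rwalk G \<omega> m)"
  then obtain n \<phi> where "\<phi> \<in> hom_box N z" "\<forall>m\<ge>n. 0 \<le> \<phi> (rwalk G \<omega> m)" by blast
  then have "\<forall>M. \<exists>\<phi>\<in>hom_box N z. \<forall>m\<in>{n..M}. 0 \<le> \<phi> (rwalk G \<omega> m)"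
    by (intro allI bexI[of _ \<phi>]) auto
  then show "\<omega> \<in> pos_event N z" using assms(2) unfolding pos_event_def by blast
qed

lemma pos_event_block_swap:
  assumes "N > 0"
  shows "block_swap k \<omega> \<in> pos_event N z \<longleftrightarrow> \<omega> \<in> pos_event N z"
proof -
  have *: "block_swap k \<omega> \<in> pos_event N z" if w: "\<omega> \<in> pos_event N z" for \<omega>
  proof -
    have p: "\<omega> \<in> paths" using that by (simp add: pos_event_def)
    obtain n \<phi> where n: "\<phi> \<in> hom_box N z" "\<forall>m\<ge>n. 0 \<le> \<phi> (rwalk G \<omega> m)"
      using w pos_event_iff[OF assms p] by blast
    have hom: "real_hom G \<phi>" using n(1) homs_hom by (simp add: hom_box_def)
    have "\<forall>m\<ge>max n (2 * k). 0 \<le> \<phi> (rwalk G (block_swap k \<omega>) m)"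
      using n(2) real_hom_rwalk_block_swap[OF hom p, of k] by simp
    then show ?thesis using n(1) pos_event_iff[OF assms block_swap_paths[OF p]] by blast
  qed
  show ?thesis using *[of \<omega>] *[of "block_swap k \<omega>"] block_swap_block_swap by metis
qed

lemma pos_event_0_1:
  assumes "N > 0"
  shows "measure W.S (pos_event N z) = 0 \<or> measure W.S (pos_event N z) = 1"
  by (rule W.hewitt_savage[OF sets_pos_event]) (rule pos_event_block_swap[OF assms])

text \<open>The identity outside the carrier makes this an involution of the whole type.\<close>

definition flip :: "'a \<Rightarrow> 'a" where
  "flip x = (if x \<in> carrier G then inv x else x)"

lemma map_pmf_flip: "map_pmf flip \<mu> = \<mu>"
proof (rule pmf_eqI)
  fix x
  have "flip (flip y) = y" for y by (simp add: flip_def)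
  then have "inj flip" by (metis injI)
  moreover have "flip (flip x) = x" by (simp add: flip_def)
  ultimately have "pmf (map_pmf flip \<mu>) x = pmf \<mu> (flip x)"
    using pmf_map_inj'[of flip \<mu> "flip x"] by simp
  also have "\<dots> = pmf \<mu> x"
    using symmetric by (auto simp: flip_def symmetric_measure_def)
  finally show "pmf (map_pmf flip \<mu>) x = pmf \<mu> x" .
qed

lemma flip_support: "x \<in> set_pmf \<mu> \<Longrightarrow> flip x \<in> set_pmf \<mu>"
  using map_pmf_flip by (metis imageI set_map_pmf)

lemma prod_emb_eq: "prod_emb UNIV (\<lambda>_. measure_pmf \<mu>) J (PiE J F) = {\<omega>. \<forall>j\<in>J. \<omega> j \<in> F j}"
  by (auto simp: prod_emb_iff PiE_iff)

lemma measurable_flip: "(\<lambda>\<omega> i. flip (\<omega> i)) \<in> measurable W.S W.S"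
proof (rule measurable_PiM_single'[where f = "\<lambda>i \<omega>. flip (\<omega> i)" and N = W.S and M = "\<lambda>_. measure_pmf \<mu>" and I = UNIV])
  fix i :: nat
  have "(\<lambda>\<omega>. \<omega> i) \<in> measurable W.S (measure_pmf \<mu>)" by (rule measurable_component_singleton) simp
  moreover have "flip \<in> measurable (measure_pmf \<mu>) (measure_pmf \<mu>)" by simp
  ultimately show "(\<lambda>\<omega>. flip (\<omega> i)) \<in> measurable W.S (measure_pmf \<mu>)" by (rule measurable_compose)
qed (simp add: PiE_UNIV_domain)

lemma distr_flip: "distr W.S W.S (\<lambda>\<omega> i. flip (\<omega> i)) = W.S"
proof (rule W.PiM_eq)
  fix J :: "nat set" and F :: "nat \<Rightarrow> 'a set"
  assume J: "finite J"
  let ?E = "prod_emb UNIV (\<lambda>_. measure_pmf \<mu>) J (PiE J F)"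
  have E: "?E \<in> sets W.S" using J by (intro sets_PiM_I) auto
  have "(\<lambda>\<omega> i. flip (\<omega> i)) -` ?E \<inter> space W.S
    = prod_emb UNIV (\<lambda>_. measure_pmf \<mu>) J (PiE J (\<lambda>j. flip -` F j))"
    unfolding prod_emb_eq by auto
  then have "emeasure (distr W.S W.S (\<lambda>\<omega> i. flip (\<omega> i))) ?E
    = (\<Prod>j\<in>J. emeasure (measure_pmf \<mu>) (flip -` F j))"
    using emeasure_distr[OF measurable_flip E] W.emeasure_PiM_emb[OF _ J, of "\<lambda>j. flip -` F j"] by simp
  also have "\<dots> = (\<Prod>j\<in>J. emeasure (measure_pmf \<mu>) (F j))"
  proof (rule prod.cong)
    fix j assume "j \<in> J"
    have "emeasure (measure_pmf \<mu>) (F j) = emeasure (measure_pmf (map_pmf flip \<mu>)) (F j)"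
      by (simp add: map_pmf_flip)
    then show "emeasure (measure_pmf \<mu>) (flip -` F j) = emeasure (measure_pmf \<mu>) (F j)"
      by (simp add: emeasure_map_pmf)
  qed simp
  finally show "emeasure (distr W.S W.S (\<lambda>\<omega> i. flip (\<omega> i))) ?E = (\<Prod>j\<in>J. emeasure (measure_pmf \<mu>) (F j))" .
qed simp

text \<open>Inverting every increment negates the values of a real homomorphism along the walk,
  although in a noncommutative group the new walk need not be the inverse of the old one.\<close>

lemma pos_event_flip:
  assumes N: "N > 0" and z: "length z = length fs" and w: "\<omega> \<in> pos_event N z"
  shows "(\<lambda>i. flip (\<omega> i)) \<in> pos_event N (map uminus z)"
proof -
  have p: "\<omega> \<in> paths" using w by (simp add: pos_event_def)
  have p': "(\<lambda>i. flip (\<omega> i)) \<in> paths" using p flip_support by (simp add: paths_def)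
  obtain n \<phi> where n: "\<phi> \<in> hom_box N z" "\<forall>m\<ge>n. 0 \<le> \<phi> (rwalk G \<omega> m)"
    using w pos_event_iff[OF N p] by blast
  have hom: "real_hom G \<phi>" using n(1) homs_hom by (simp add: hom_box_def)
  have "\<bar>real N * (- \<phi> (fs ! i)) - real_of_int (map uminus z ! i)\<bar> \<le> 1" if "i < length fs" for i
  proof -
    have "\<bar>real N * \<phi> (fs ! i) - real_of_int (z ! i)\<bar> \<le> 1" using n(1) that by (simp add: hom_box_def)
    then show ?thesis using that z by simp
  qed
  then have "(\<lambda>x. - \<phi> x) \<in> hom_box N (map uminus z)"
    using n(1) by (simp add: hom_box_def homs_def real_hom_def)
  moreover have "- \<phi> (rwalk G (\<lambda>i. flip (\<omega> i)) m) = \<phi> (rwalk G \<omega> m)" for m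
  proof -
    have "\<phi> (flip (\<omega> i)) = - \<phi> (\<omega> i)" for i
      using paths_carrier[OF p] real_hom_inv[OF hom] by (simp add: flip_def)
    then show ?thesis using real_hom_rwalk[OF hom p] real_hom_rwalk[OF hom p'] by (simp add: sum_negf)
  qed
  then have "\<forall>m\<ge>n. 0 \<le> - \<phi> (rwalk G (\<lambda>i. flip (\<omega> i)) m)" using n(2) by simp
  ultimately show ?thesis
    unfolding pos_event_iff[OF N p'] by (intro exI[of _ n] bexI[of _ "\<lambda>x. - \<phi> x"])
qed

text \<open>An event of positive probability is almost sure by the zero-one law, and the flip makes
  its opposite at least as likely. The pairs \<open>(N, z)\<close> are countably many, so one null
  set serves them all.\<close>

lemma AE_pos_event_symmetric:
  "AE \<omega> in W.S. \<forall>N z. N > 0 \<longrightarrow> length z = length fs \<longrightarrow> \<omega> \<in> pos_event N z \<longrightarrow> \<omega> \<in> pos_event N (map uminus z)"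
proof -
  have "AE \<omega> in W.S. N > 0 \<longrightarrow> length z = length fs \<longrightarrow> \<omega> \<in> pos_event N z \<longrightarrow> \<omega> \<in> pos_event N (map uminus z)" for N z
  proof (cases "N > 0 \<and> length z = length fs")
    case False
    then show ?thesis by auto
  next
    case True
    then have N: "N > 0" and z: "length z = length fs" by auto
    show ?thesis
    proof (cases "measure W.S (pos_event N z) = 0")
      case True
      then have "AE \<omega> in W.S. \<omega> \<notin> pos_event N z" using W.P.prob_eq_0[OF sets_pos_event] by blast
      then show ?thesis by (rule AE_mp) simp
    next
      case False
      then have "1 = measure W.S (pos_event N z)" using pos_event_0_1[OF N] by metis
      also have "\<dots> \<le> measure W.S ((\<lambda>\<omega> i. flip (\<omega> i)) -` pos_event N (map uminus z) \<inter> space W.S)"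
        using pos_event_flip[OF N z] measurable_sets[OF measurable_flip sets_pos_event]
        by (intro W.P.finite_measure_mono) auto
      also have "\<dots> = measure (distr W.S W.S (\<lambda>\<omega> i. flip (\<omega> i))) (pos_event N (map uminus z))"
        by (rule measure_distr[OF measurable_flip sets_pos_event, symmetric])
      finally have "measure W.S (pos_event N (map uminus z)) \<ge> 1" unfolding distr_flip .
      then have "measure W.S (pos_event N (map uminus z)) = 1"
        using W.P.prob_le_1[of "pos_event N (map uminus z)"] by linarith
      then have "AE \<omega> in W.S. \<omega> \<in> pos_event N (map uminus z)" by (rule W.P.AE_prob_1)
      then show ?thesis by (rule AE_mp) simp
    qed
  qed
  then show ?thesis by (simp add: AE_all_countable)
qed

text \<open>Missing \<open>x\<close> at \<open>K\<close> given times has probability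
  \<open>q ^ K\<close>, which tends to 0; there are countably many \<open>x\<close> and
  \<open>n\<close> to consider.\<close>

lemma AE_infinitely_often: "AE \<omega> in W.S. \<forall>x\<in>set_pmf \<mu>. \<forall>n. \<exists>m\<ge>n. \<omega> m = x"
proof -
  have "AE \<omega> in W.S. \<exists>m\<ge>n. \<omega> m = x" if x: "x \<in> set_pmf \<mu>" for x n
  proof -
    define A where "A = {\<omega>. \<forall>m\<ge>n. \<omega> m \<noteq> x}"
    have "A = (\<Inter>m\<in>{n..}. {\<omega>. \<omega> m \<in> - {x}})" by (auto simp: A_def)
    also have "\<dots> \<in> sets W.S" using sets.top[of W.S] by (intro sets.countable_INT'' sets_coordinate) auto
    finally have A: "A \<in> sets W.S" .
    define q where "q = 1 - pmf \<mu> x"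
    have q: "0 \<le> q" "q < 1" using x by (auto simp: q_def pmf_le_1 pmf_positive)
    have "measure W.S A \<le> q ^ K" for K
    proof -
      let ?J = "{n..<n + K}"
      have "measure W.S A \<le> measure W.S (prod_emb UNIV (\<lambda>_. measure_pmf \<mu>) ?J (PiE ?J (\<lambda>_. - {x})))"
      proof (rule W.P.finite_measure_mono)
        show "A \<subseteq> prod_emb UNIV (\<lambda>_. measure_pmf \<mu>) ?J (PiE ?J (\<lambda>_. - {x}))"
          unfolding prod_emb_eq by (auto simp: A_def)
      qed (intro sets_PiM_I, auto)
      also have "\<dots> = (\<Prod>i\<in>?J. measure (measure_pmf \<mu>) (- {x}))"
        by (rule W.measure_PiM_emb) auto
      also have "measure (measure_pmf \<mu>) (- {x}) = q"
        using measure_pmf.prob_compl[of "{x}" \<mu>] by (simp add: q_def measure_pmf_single Compl_eq_Diff_UNIV)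
      finally show ?thesis by simp
    qed
    moreover have "(\<lambda>K. q ^ K) \<longlonglongrightarrow> 0" using q by (intro LIMSEQ_realpow_zero)
    ultimately have "measure W.S A \<le> 0" by (intro LIMSEQ_le_const) auto
    then have "measure W.S A = 0" using measure_nonneg[of W.S A] by linarith
    then have "AE \<omega> in W.S. \<omega> \<notin> A" using W.P.prob_eq_0[OF A] by blast
    then show ?thesis by (rule AE_mp) (auto simp: A_def)
  qed
  then show ?thesis by (simp add: AE_ball_countable AE_all_countable)
qed

section \<open>The cone of eventually nonnegative functionals and its span\<close>

lemma homs_add: "\<phi> \<in> homs \<Longrightarrow> \<psi> \<in> homs \<Longrightarrow> (\<lambda>x. \<phi> x + \<psi> x) \<in> homs"
  by (simp add: homs_def real_hom_def)

lemma homs_scale: "\<phi> \<in> homs \<Longrightarrow> (\<lambda>x. t * \<phi> x) \<in> homs"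
  by (simp add: homs_def real_hom_def algebra_simps)

definition pos_cone :: "(nat \<Rightarrow> 'a) \<Rightarrow> ('a \<Rightarrow> real) set" where
  "pos_cone \<omega> = {\<phi>\<in>homs. \<forall>\<^sub>F m in sequentially. 0 \<le> \<phi> (rwalk G \<omega> m)}"

lemma pos_cone_homs: "\<phi> \<in> pos_cone \<omega> \<Longrightarrow> \<phi> \<in> homs"
  by (simp add: pos_cone_def)

lemma pos_cone_zero: "(\<lambda>_. 0) \<in> pos_cone \<omega>"
  by (simp add: pos_cone_def homs_def real_hom_def)

lemma pos_cone_add:
  assumes "\<phi> \<in> pos_cone \<omega>" "\<psi> \<in> pos_cone \<omega>"
  shows "(\<lambda>x. \<phi> x + \<psi> x) \<in> pos_cone \<omega>"
proof -
  have "\<forall>\<^sub>F m in sequentially. 0 \<le> \<phi> (rwalk G \<omega> m)" "\<forall>\<^sub>F m in sequentially. 0 \<le> \<psi> (rwalk G \<omega> m)"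
    using assms by (simp_all add: pos_cone_def)
  then have "\<forall>\<^sub>F m in sequentially. 0 \<le> \<phi> (rwalk G \<omega> m) + \<psi> (rwalk G \<omega> m)"
    by eventually_elim simp
  then show ?thesis using assms homs_add by (simp add: pos_cone_def)
qed

lemma pos_cone_scale:
  assumes "\<phi> \<in> pos_cone \<omega>" "t \<ge> 0"
  shows "(\<lambda>x. t * \<phi> x) \<in> pos_cone \<omega>"
proof -
  have "\<forall>\<^sub>F m in sequentially. 0 \<le> \<phi> (rwalk G \<omega> m)" using assms by (simp add: pos_cone_def)
  then have "\<forall>\<^sub>F m in sequentially. 0 \<le> t * \<phi> (rwalk G \<omega> m)"
    by eventually_elim (use assms in simp)
  then show ?thesis using assms homs_scale by (simp add: pos_cone_def)
qed

text \<open>For a convex cone, differences of two elements already exhaust the linear span.\<close>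

definition pos_span :: "(nat \<Rightarrow> 'a) \<Rightarrow> ('a \<Rightarrow> real) set" where
  "pos_span \<omega> = {\<lambda>x. \<phi> x - \<psi> x | \<phi> \<psi>. \<phi> \<in> pos_cone \<omega> \<and> \<psi> \<in> pos_cone \<omega>}"

lemma pos_spanI: "\<phi> \<in> pos_cone \<omega> \<Longrightarrow> \<psi> \<in> pos_cone \<omega> \<Longrightarrow> (\<lambda>x. \<phi> x - \<psi> x) \<in> pos_span \<omega>"
  unfolding pos_span_def by blast

lemma pos_spanE:
  assumes "\<phi> \<in> pos_span \<omega>"
  obtains \<alpha> \<beta> where "\<alpha> \<in> pos_cone \<omega>" "\<beta> \<in> pos_cone \<omega>" "\<phi> = (\<lambda>x. \<alpha> x - \<beta> x)"
  using assms unfolding pos_span_def by blast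

lemma pos_cone_span: "\<phi> \<in> pos_cone \<omega> \<Longrightarrow> \<phi> \<in> pos_span \<omega>"
  using pos_spanI[OF _ pos_cone_zero, of \<phi> \<omega>] by simp

lemma pos_span_homs: "\<phi> \<in> pos_span \<omega> \<Longrightarrow> \<phi> \<in> homs"
proof (erule pos_spanE)
  fix \<alpha> \<beta> assume "\<alpha> \<in> pos_cone \<omega>" "\<beta> \<in> pos_cone \<omega>" "\<phi> = (\<lambda>x. \<alpha> x - \<beta> x)"
  then show "\<phi> \<in> homs" using homs_add[of \<alpha> "\<lambda>x. - 1 * \<beta> x"] homs_scale[of \<beta> "- 1"] pos_cone_homs by simp
qed

lemma pos_span_add_cone:
  assumes "\<phi> \<in> pos_span \<omega>" "\<psi> \<in> pos_cone \<omega>"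
  shows "(\<lambda>x. \<phi> x + \<psi> x) \<in> pos_span \<omega>"
  using assms(1)
proof (rule pos_spanE)
  fix \<alpha> \<beta> assume *: "\<alpha> \<in> pos_cone \<omega>" "\<beta> \<in> pos_cone \<omega>" "\<phi> = (\<lambda>x. \<alpha> x - \<beta> x)"
  have "(\<lambda>x. (\<alpha> x + \<psi> x) - \<beta> x) \<in> pos_span \<omega>"
    using pos_spanI[OF pos_cone_add[OF *(1) assms(2)] *(2)] .
  then show ?thesis using *(3) by (simp add: algebra_simps)
qed

lemma pos_span_scale:
  assumes "\<phi> \<in> pos_span \<omega>" "t \<ge> 0"
  shows "(\<lambda>x. t * \<phi> x) \<in> pos_span \<omega>"
  using assms(1)
proof (rule pos_spanE)
  fix \<alpha> \<beta> assume *: "\<alpha> \<in> pos_cone \<omega>" "\<beta> \<in> pos_cone \<omega>" "\<phi> = (\<lambda>x. \<alpha> x - \<beta> x)"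
  have "(\<lambda>x. t * \<alpha> x - t * \<beta> x) \<in> pos_span \<omega>"
    using pos_spanI[OF pos_cone_scale[OF *(1) assms(2)] pos_cone_scale[OF *(2) assms(2)]] .
  then show ?thesis using *(3) by (simp add: algebra_simps)
qed

lemma pos_span_uminus:
  assumes "\<phi> \<in> pos_span \<omega>"
  shows "(\<lambda>x. - \<phi> x) \<in> pos_span \<omega>"
  using assms(1)
proof (rule pos_spanE)
  fix \<alpha> \<beta> assume *: "\<alpha> \<in> pos_cone \<omega>" "\<beta> \<in> pos_cone \<omega>" "\<phi> = (\<lambda>x. \<alpha> x - \<beta> x)"
  show ?thesis using pos_spanI[OF *(2,1)] *(3) by simp
qed

text \<open>Rounding \<open>\<phi>\<close> to the grid of mesh \<open>1 / N\<close> costs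
  \<open>1 / N\<close>, and the opposite box contains some \<open>c\<close> of the cone within
  \<open>1 / N\<close> of the opposite grid point; hence the bound \<open>2 / N\<close>.\<close>

lemma pos_cone_approx_uminus:
  assumes p: "\<omega> \<in> paths"
    and sym: "\<forall>N z. N > 0 \<longrightarrow> length z = length fs \<longrightarrow> \<omega> \<in> pos_event N z \<longrightarrow> \<omega> \<in> pos_event N (map uminus z)"
    and \<phi>: "\<phi> \<in> pos_cone \<omega>" and N: "N > 0"
  shows "\<exists>c\<in>pos_cone \<omega>. \<forall>f\<in>set fs. \<bar>\<phi> f + c f\<bar> \<le> 2 / real N"
proof -
  define z where "z = map (\<lambda>f. \<lfloor>real N * \<phi> f\<rfloor>) fs"
  have z: "length z = length fs" by (simp add: z_def)
  have box: "\<bar>real N * \<phi> (fs ! i) - real_of_int (z ! i)\<bar> \<le> 1" if "i < length fs" for i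
    using that unfolding z_def by (simp, linarith)
  then have "\<phi> \<in> hom_box N z" using pos_cone_homs[OF \<phi>] by (simp add: hom_box_def)
  moreover obtain n where "\<forall>m\<ge>n. 0 \<le> \<phi> (rwalk G \<omega> m)"
    using \<phi> by (auto simp: pos_cone_def eventually_sequentially)
  ultimately have "\<omega> \<in> pos_event N z" using pos_event_iff[OF N p] by blast
  then have "\<omega> \<in> pos_event N (map uminus z)" using sym N z by simp
  then obtain k c where c: "c \<in> hom_box N (map uminus z)" "\<forall>m\<ge>k. 0 \<le> c (rwalk G \<omega> m)"
    using pos_event_iff[OF N p] by blast
  have "c \<in> pos_cone \<omega>" using c unfolding pos_cone_def hom_box_def eventually_sequentially by blast
  moreover have "\<bar>\<phi> f + c f\<bar> \<le> 2 / real N" if f: "f \<in> set fs" for f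
  proof -
    obtain i where i: "i < length fs" "f = fs ! i" using f in_set_conv_nth[of f fs] by auto
    have "\<bar>real N * c f - real_of_int (map uminus z ! i)\<bar> \<le> 1" using c(1) i by (simp add: hom_box_def)
    then have "\<bar>real N * c f + real_of_int (z ! i)\<bar> \<le> 1" using i z by simp
    then have "\<bar>real N * \<phi> f + real N * c f\<bar> \<le> 2" using box[OF i(1)] unfolding i(2) by linarith
    then have "real N * \<bar>\<phi> f + c f\<bar> \<le> 2" by (simp add: abs_mult distrib_left[symmetric])
    then show ?thesis using N by (simp add: field_simps)
  qed
  ultimately show ?thesis by blast
qed

text \<open>By total boundedness, finitely many \<open>c\<close> in the cone approximate the negatives of all \<open>\<phi>\<close> in the
  unit ball of its span. Once all these \<open>c\<close> are nonnegative at \<open>X\<^sub>m\<close>, the supremum \<open>s\<close> of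
  \<open>\<phi> X\<^sub>m = (\<phi> + c) X\<^sub>m - c X\<^sub>m\<close> over the ball satisfies \<open>s \<le> s / 4\<close>.\<close>

lemma pos_span_vanishes:
  assumes p: "\<omega> \<in> paths"
    and sym: "\<forall>N z. N > 0 \<longrightarrow> length z = length fs \<longrightarrow> \<omega> \<in> pos_event N z \<longrightarrow> \<omega> \<in> pos_event N (map uminus z)"
  shows "\<forall>\<^sub>F m in sequentially. \<forall>\<phi>\<in>pos_span \<omega>. \<phi> (rwalk G \<omega> m) = 0"
proof -
  define B where "B = {\<phi>\<in>pos_span \<omega>. \<forall>f\<in>set fs. \<bar>\<phi> f\<bar> \<le> 1}"
  \<comment> \<open>Elements of \<open>B\<close> with the same \<open>key\<close> differ by at most
    \<open>1 / 16\<close> on each generator. Together with the \<open>2 / 16\<close> of the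
    approximate negative this stays below \<open>1 / 4\<close>.\<close>
  define key where "key \<phi> = map (\<lambda>f. \<lfloor>16 * \<phi> f\<rfloor>) fs" for \<phi> :: "'a \<Rightarrow> real"
  have "key ` B \<subseteq> {l. set l \<subseteq> {-16..16} \<and> length l = length fs}"
  proof
    fix l assume "l \<in> key ` B"
    then obtain \<phi> where \<phi>: "\<phi> \<in> B" "l = key \<phi>" by blast
    have "\<lfloor>16 * \<phi> f\<rfloor> \<in> {-16..16}" if "f \<in> set fs" for f
    proof -
      have "\<bar>\<phi> f\<bar> \<le> 1" using \<phi> that by (simp add: B_def)
      then have "-16 \<le> 16 * \<phi> f" "16 * \<phi> f \<le> 16" by linarith+
      then show ?thesis by (simp add: le_floor_iff floor_le_iff)
    qed
    then show "l \<in> {l. set l \<subseteq> {-16..16} \<and> length l = length fs}" using \<phi>(2) by (auto simp: key_def)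
  qed
  then have fin: "finite (key ` B)" by (rule finite_subset) (intro finite_lists_length_eq, simp)
  have "\<exists>c. c \<in> pos_cone \<omega> \<and> (\<forall>\<phi>\<in>B. key \<phi> = k \<longrightarrow> (\<forall>f\<in>set fs. \<bar>\<phi> f + c f\<bar> \<le> 1 / 4))" if k: "k \<in> key ` B" for k
  proof -
    obtain \<psi> where \<psi>: "\<psi> \<in> B" "k = key \<psi>" using k by blast
    \<comment> \<open>Only elements of the cone itself have approximate negatives in it. As
      \<open>\<psi>\<close> is \<open>\<alpha> - \<beta>\<close>, its approximate negative is
      \<open>c + \<beta>\<close> with \<open>c\<close> close to \<open>- \<alpha>\<close>.\<close>
    obtain \<alpha> \<beta> where ab: "\<alpha> \<in> pos_cone \<omega>" "\<beta> \<in> pos_cone \<omega>" "\<psi> = (\<lambda>x. \<alpha> x - \<beta> x)"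
      using \<psi>(1) pos_spanE unfolding B_def by blast
    obtain c where c: "c \<in> pos_cone \<omega>" "\<forall>f\<in>set fs. \<bar>\<alpha> f + c f\<bar> \<le> 2 / real 16"
      using pos_cone_approx_uminus[OF p sym ab(1), of 16] by auto
    have "\<bar>\<phi> f + (c f + \<beta> f)\<bar> \<le> 1 / 4" if "\<phi> \<in> B" "key \<phi> = k" "f \<in> set fs" for \<phi> f
    proof -
      have "\<lfloor>16 * \<phi> f\<rfloor> = \<lfloor>16 * \<psi> f\<rfloor>" using that \<psi>(2) by (simp add: key_def)
      then have "\<bar>\<phi> f - \<psi> f\<bar> \<le> 1 / 16" by linarith
      moreover have "\<bar>\<alpha> f + c f\<bar> \<le> 1 / 8" using c(2) that(3) by simp
      ultimately show ?thesis unfolding ab(3) by linarith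
    qed
    then show ?thesis using pos_cone_add[OF c(1) ab(2)] by (intro exI[of _ "\<lambda>x. c x + \<beta> x"]) blast
  qed
  then obtain c where c: "\<And>k. k \<in> key ` B \<Longrightarrow> c k \<in> pos_cone \<omega>"
    "\<And>k \<phi> f. k \<in> key ` B \<Longrightarrow> \<phi> \<in> B \<Longrightarrow> key \<phi> = k \<Longrightarrow> f \<in> set fs \<Longrightarrow> \<bar>\<phi> f + c k f\<bar> \<le> 1 / 4"
    by metis
  have "\<forall>\<^sub>F m in sequentially. \<forall>k\<in>key ` B. 0 \<le> c k (rwalk G \<omega> m)"
    using c(1) by (intro eventually_ball_finite[OF fin]) (simp add: pos_cone_def)
  then show ?thesis
  proof eventually_elim
    case (elim m)
    define x where "x = rwalk G \<omega> m"
    \<comment> \<open>This bound makes the supremum \<open>s\<close> finite, without which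
      \<open>s \<le> s / 4\<close> would say nothing.\<close>
    obtain b where b: "\<forall>\<phi>\<in>homs. \<forall>r\<ge>0. (\<forall>f\<in>set fs. \<bar>\<phi> f\<bar> \<le> r) \<longrightarrow> \<bar>\<phi> x\<bar> \<le> b * r"
      using homs_bound[OF rwalk_carrier[OF p]] unfolding x_def by blast
    have bB: "\<phi> x \<le> b" if "\<phi> \<in> B" for \<phi>
    proof -
      have "\<phi> \<in> homs" "\<forall>f\<in>set fs. \<bar>\<phi> f\<bar> \<le> 1" using that pos_span_homs by (auto simp: B_def)
      then have "\<bar>\<phi> x\<bar> \<le> b * 1" using b zero_le_one by blast
      then show ?thesis by simp
    qed
    define s where "s = (SUP \<phi>\<in>B. \<phi> x)"
    have bdd: "bdd_above ((\<lambda>\<phi>. \<phi> x) ` B)" using bB by (intro bdd_aboveI[of _ b]) auto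
    have zB: "(\<lambda>_. 0) \<in> B" using pos_cone_span[OF pos_cone_zero] by (simp add: B_def)
    have le: "\<phi> x \<le> s / 4" if \<phi>: "\<phi> \<in> B" for \<phi>
    proof -
      let ?c = "c (key \<phi>)"
      have k: "key \<phi> \<in> key ` B" using \<phi> by blast
      have "(\<lambda>y. 4 * (\<phi> y + ?c y)) \<in> pos_span \<omega>"
        using pos_span_scale[OF pos_span_add_cone[OF _ c(1)[OF k]], of \<phi> 4] \<phi> by (simp add: B_def)
      moreover have "\<bar>4 * (\<phi> f + ?c f)\<bar> \<le> 1" if "f \<in> set fs" for f
        unfolding abs_mult using c(2)[OF k \<phi> refl that] by simp
      ultimately have "(\<lambda>y. 4 * (\<phi> y + ?c y)) \<in> B" by (simp add: B_def)
      then have "4 * (\<phi> x + ?c x) \<le> s" unfolding s_def by (rule cSUP_upper[OF _ bdd, of "\<lambda>y. 4 * (\<phi> y + ?c y)"])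
      moreover have "0 \<le> ?c x" using elim k unfolding x_def by blast
      ultimately show ?thesis by simp
    qed
    have "(SUP \<phi>\<in>B. \<phi> x) \<le> s / 4" by (rule cSUP_least) (use zB le in auto)
    then have "s \<le> s / 4" unfolding s_def[symmetric] .
    then have s: "s \<le> 0" by simp
    have "\<phi> x = 0" if \<phi>: "\<phi> \<in> pos_span \<omega>" for \<phi>
    proof -
      define r where "r = (\<Sum>f\<in>set fs. \<bar>\<phi> f\<bar>)"
      have r: "r \<ge> 0" unfolding r_def by (intro sum_nonneg) simp
      \<comment> \<open>Scaled by \<open>t\<close>, both \<open>\<phi>\<close> and its negative lie
        in \<open>B\<close>, where values at \<open>x\<close> are at most 0.\<close>
      define t where "t = 1 / (1 + r)"
      have t: "t > 0" using r by (simp add: t_def)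
      have tB: "\<bar>t * \<phi> f\<bar> \<le> 1" if "f \<in> set fs" for f
      proof -
        have "\<bar>\<phi> f\<bar> \<le> r" unfolding r_def using that by (intro member_le_sum) auto
        then show ?thesis using r by (simp add: t_def)
      qed
      have "(\<lambda>y. t * \<phi> y) \<in> B" using pos_span_scale[OF \<phi>, of t] t tB by (simp add: B_def)
      moreover have "(\<lambda>y. - (t * \<phi> y)) \<in> B"
        using pos_span_uminus[OF pos_span_scale[OF \<phi>, of t]] t tB by (simp add: B_def)
      ultimately have "t * \<phi> x \<le> 0" "- (t * \<phi> x) \<le> 0" using le[of "\<lambda>y. t * \<phi> y"] le[of "\<lambda>y. - (t * \<phi> y)"] s by auto
      then have "t * \<phi> x = 0" by linarith
      then show ?thesis using t by simp
    qed
    then show ?case by (simp add: x_def)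
  qed
qed

lemma no_nonneg_real_hom:
  assumes p: "\<omega> \<in> paths"
    and sym: "\<forall>N z. N > 0 \<longrightarrow> length z = length fs \<longrightarrow> \<omega> \<in> pos_event N z \<longrightarrow> \<omega> \<in> pos_event N (map uminus z)"
    and io: "\<forall>x\<in>set_pmf \<mu>. \<forall>n. \<exists>m\<ge>n. \<omega> m = x"
    and \<phi>: "real_hom G \<phi>" "\<forall>m\<ge>n. 0 \<le> \<phi> (rwalk G \<omega> m)" and x: "x \<in> carrier G"
  shows "\<phi> x = 0"
proof -
  \<comment> \<open>The cut-off outside the carrier makes the functional an element of
    \<open>homs\<close>; the walk stays inside the carrier.\<close>
  define \<psi> where "\<psi> y = (if y \<in> carrier G then \<phi> y else 0)" for y
  have "\<psi> \<in> homs" using \<phi>(1) by (simp add: homs_def real_hom_def \<psi>_def)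
  moreover have "\<forall>m\<ge>n. 0 \<le> \<psi> (rwalk G \<omega> m)" using \<phi>(2) by (simp add: \<psi>_def)
  ultimately have "\<psi> \<in> pos_cone \<omega>" unfolding pos_cone_def eventually_sequentially by blast
  then have "\<psi> \<in> pos_span \<omega>" by (rule pos_cone_span)
  then obtain k where k: "\<And>m. m \<ge> k \<Longrightarrow> \<psi> (rwalk G \<omega> m) = 0"
    using pos_span_vanishes[OF p sym] unfolding eventually_sequentially by blast
  have "\<phi> y = 0" if y: "y \<in> set_pmf \<mu>" for y
  proof -
    obtain m where m: "m \<ge> k" "\<omega> m = y" using io y by blast
    have "\<phi> (rwalk G \<omega> m) = 0" "\<phi> (rwalk G \<omega> (Suc m)) = 0"
      using k[of m] k[of "Suc m"] m(1) rwalk_carrier[OF p, of m] rwalk_carrier[OF p, of "Suc m"]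
      by (simp_all add: \<psi>_def)
    then show ?thesis
      using real_hom_rwalk[OF \<phi>(1) p, of m] real_hom_rwalk[OF \<phi>(1) p, of "Suc m"] m(2)
      by (simp del: rwalk.simps)
  qed
  then show ?thesis
    using real_hom_eq_zero_generate[OF \<phi>(1), of "set_pmf \<mu>" x] generate_support support_carrier x by blast
qed

lemma mult_closed_semigroup_gen:
  assumes "X \<subseteq> carrier G"
  shows "mult_closed G (semigroup_gen G X)"
proof -
  have "x \<in> carrier G" if "x \<in> semigroup_gen G X" for x
    using that by (induction rule: semigroup_gen.induct) (use assms in auto)
  then show ?thesis unfolding mult_closed_def by (auto intro: semigroup_gen.mult)
qed

lemma semigroup_gen_walk_eq_carrier:
  assumes p: "\<omega> \<in> paths"
    and sym: "\<forall>N z. N > 0 \<longrightarrow> length z = length fs \<longrightarrow> \<omega> \<in> pos_event N z \<longrightarrow> \<omega> \<in> pos_event N (map uminus z)"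
    and io: "\<forall>x\<in>set_pmf \<mu>. \<forall>n. \<exists>m\<ge>n. \<omega> m = x"
    and nil: "lower_central G c = {\<one>}"
  shows "semigroup_gen G {rwalk G \<omega> m | m. m \<ge> n} = carrier G"
proof (rule semigroup_eq_carrier[OF _ fs_carrier generate_fs _ _ _ _ nil])
  let ?X = "{rwalk G \<omega> m | m. m \<ge> n}"
  let ?S = "semigroup_gen G ?X"
  have X: "?X \<subseteq> carrier G" using rwalk_carrier[OF p] by blast
  have XS: "rwalk G \<omega> m \<in> ?S" if "m \<ge> n" for m using that by (auto intro: semigroup_gen.incl)
  show S: "mult_closed G ?S" using mult_closed_semigroup_gen[OF X] .
  show "finite (set fs)" by simp
  show "?S \<noteq> {}" using XS[of n] by auto
  show "generate G ?S = carrier G"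
  proof
    have Sc: "?S \<subseteq> carrier G" using S by (simp add: mult_closed_def)
    show "generate G ?S \<subseteq> carrier G" using generate_incl[OF Sc] .
    have sub: "subgroup (generate G ?S) G" using generate_is_subgroup[OF Sc] .
    \<comment> \<open>A support element recurs as an increment, hence is a quotient of two
      consecutive positions of the walk at times beyond \<open>n\<close>.\<close>
    have "y \<in> generate G ?S" if y: "y \<in> set_pmf \<mu>" for y
    proof -
      obtain m where m: "m \<ge> n" "\<omega> m = y" using io y by blast
      have "rwalk G \<omega> m \<in> generate G ?S" "rwalk G \<omega> (Suc m) \<in> generate G ?S"
        using XS[of m] XS[of "Suc m"] m(1) by (auto intro: generate.incl simp del: rwalk.simps)
      then have "inv (rwalk G \<omega> m) \<otimes> rwalk G \<omega> (Suc m) \<in> generate G ?S"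
        using subgroup.m_closed[OF sub] subgroup.m_inv_closed[OF sub] by blast
      then show ?thesis using m(2) rwalk_carrier[OF p, of m] paths_carrier[OF p, of m] by (simp add: inv_mult_cancel)
    qed
    then have "generate G (set_pmf \<mu>) \<subseteq> generate G ?S" by (intro generate_subgroup_incl[OF _ sub]) blast
    then show "carrier G \<subseteq> generate G ?S" using generate_support by simp
  qed
  show "\<phi> x = 0" if "real_hom G \<phi>" "\<forall>s\<in>?S. 0 \<le> \<phi> s" "x \<in> carrier G" for \<phi> x
    using no_nonneg_real_hom[OF p sym io that(1) _ that(3), of n] that(2) XS by blast
qed

end

section \<open>Algebraic recurrence\<close>

theorem mainTheorem8:
  fixes G :: "('a, 'b) monoid_scheme"
  assumes "group G" and "fin_generated G" and "nilpotent_group G"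
  shows "alg_recurrent G"
  unfolding alg_recurrent_def
proof (intro allI impI)
  fix \<mu> :: "'a pmf"
  assume \<mu>: "symmetric_measure G \<mu> \<and> generate G (set_pmf \<mu>) = carrier G"
  obtain F where F: "finite F" "F \<subseteq> carrier G" "generate G F = carrier G"
    using assms(2) by (auto simp: fin_generated_def)
  obtain fs where fs: "set fs = F" using finite_list[OF F(1)] by blast
  obtain c where c: "lower_central G c = {\<one>\<^bsub>G\<^esub>}" using assms(3) by (auto simp: nilpotent_group_def)
  interpret group G by fact
  interpret symmetric_walk G \<mu> fs by unfold_locales (use \<mu> F fs in auto)
  show "alg_recurrent_measure G \<mu>"
    unfolding alg_recurrent_measure_def increments_def
  proof
    fix n
    show "AE \<omega> in W.S. semigroup_gen G {rwalk G \<omega> m |m. n \<le> m} = carrier G"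
      using AE_paths AE_pos_event_symmetric AE_infinitely_often
      by eventually_elim (rule semigroup_gen_walk_eq_carrier[OF _ _ _ c])
  qed
qed

end
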